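(* Let $G_4$ be a Lie group with Lie algebra $\mathfrak g=\mathbb R^3\ltimes so(3)$, i.e. the real Lie algebra with basis $e_1,\dots,e_6$ and nonzero brackets (up to antisymmetry) $$[e_4,e_5]=e_6,\ [e_4,e_6]=-e_5,\ [e_5,e_6]=e_4,\ [e_4,e_2]=e_3,\ [e_5,e_1]=-e_3,\ [e_6,e_1]=e_2,\ [e_4,e_3]=-e_2,\ [e_5,e_3]=e_1,\ [e_6,e_2]=-e_1 .$$ Let $P_0=\mathrm{diag}\{1,1,1,-1,-1,-1\}$ in this basis. Then: (i) $G_4$ does not admit left-invariant symplectic structures. (ii) $G_4$ has natural left-invariant semi-para-K\"ahler structures $(\Omega,P_0,G)$ of zero scalar curvature, where $\Omega=a\,e^1\wedge e^4+b\,e^2\wedge e^5+c\,e^3\wedge e^6$ with arbitrary nonzero real $a,b,c$, and $G(X,Y)=\Omega(X,P_0Y)$. (iii) $G_4$ admits the following multiparameter families of left-invariant semi-K\"ahler 2-forms compatible with $P_0$ (the $w_{ij}$ are real parameters such that the form is nondegenerate): $$\omega_1=e^1\wedge(w_{14}e^4+w_{24}e^5+w_{34}e^6)+e^2\wedge(w_{24}e^4+w_{25}e^5+w_{26}e^6)+e^3\wedge(w_{34}e^4+w_{26}e^5+w_{36}e^6),$$ $$\omega_2=e^1\wedge(w_{14}e^4+w_{15}e^5+w_{34}e^6)+e^2\wedge(w_{15}e^4+w_{25}e^5+w_{35}e^6)+e^3\wedge(w_{34}e^4+w_{35}e^5).$$ Consequently, for every $\omega_i$ ($i=1,2$) in these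 families, $(\omega_i,P_0,g_i)$ with $g_i(X,Y)=\omega_i(X,P_0Y)$ is a left-invariant semi-para-K\"ahler structure, and $g_i$ has zero scalar curvature. (iv) $G_4$ admits four multiparameter families of left-invariant (integrable) complex structures $J$ compatible with the semi-K\"ahler 2-form $\Omega_{01}=-e^1\wedge e^4+e^2\wedge e^5+e^3\wedge e^6$. They are, up to the sign $\pm J$, of the form $$Je_1=-\psi_{44}e_1+\psi_{45}e_2+\psi_{46}e_3+\psi_{41}e_4,\quad Je_2=\varepsilon e_3,\quad Je_3=-\varepsilon e_2,\quad Je_4=\psi_{14}e_1-\psi_{15}e_2-\psi_{16}e_3+\psi_{44}e_4,$$ $$Je_5=\psi_{15}e_1+\psi_{25}e_2+\psi_{26}e_3+\psi_{45}e_4+\varepsilon e_6,\quad Je_6=\psi_{16}e_1+\psi_{26}e_2+\psi_{36}e_3+\psi_{46}e_4-\varepsilon e_5,$$ with: Family 1 (real parameters $\psi_{41}\ne0$, $\psi_{45}\neq0$, $\psi_{46}$): $\varepsilon=1$, $\psi_{14}=-\frac{\psi_{45}^2+\psi_{46}^2}{\psi_{41}\psi_{45}^2}$, $\psi_{15}=0$, $\psi_{16}=\frac{\psi_{45}^2+\psi_{46}^2}{\psi_{41}\psi_{45}}$, $\psi_{25}=\frac{\psi_{45}^2}{\psi_{41}}$, $\psi_{26}=\frac{\psi_{45}\psi_{46}}{\psi_{41}}$, $\psi_{36}=\frac{\psi_{46}^2}{\psi_{41}}$, $\psi_{44}=-\frac{\psi_{46}}{\psi_{45}}$. Family 2 (real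 parameters $\psi_{14}\ne0$, $\psi_{44},\psi_{45},\psi_{46}$ with $D:=\psi_{45}\psi_{44}+\psi_{46}\ne0$): $\varepsilon=1$, $\psi_{15}=\frac{D\,\psi_{14}}{\psi_{44}^2+1}$, $\psi_{16}=\frac{\psi_{15}(\psi_{46}\psi_{44}-\psi_{45})}{D}$, $\psi_{25}=-\frac{\psi_{15}\psi_{45}^2}{D}$, $\psi_{26}=-\frac{\psi_{15}\psi_{45}\psi_{46}}{D}$, $\psi_{36}=-\frac{\psi_{15}\psi_{46}^2}{D}$, $\psi_{41}=-\frac{D}{\psi_{15}}$. Family 3 (real parameters $\psi_{41}\ne0$, $\psi_{46}\ne0$, $\psi_{16}$): $\varepsilon=-1$, $\psi_{14}=-\frac{\psi_{16}^2\psi_{41}^2+\psi_{46}^2}{\psi_{41}\psi_{46}^2}$, $\psi_{15}=\frac{\psi_{46}}{\psi_{41}}$, $\psi_{25}=\psi_{26}=0$, $\psi_{36}=\frac{\psi_{46}^2}{\psi_{41}}$, $\psi_{44}=-\frac{\psi_{16}\psi_{41}}{\psi_{46}}$, $\psi_{45}=0$. Family 4 (real parameters $\psi_{41}\ne0$, $\psi_{44}$): $\varepsilon=1$, $\psi_{14}=-\frac{\psi_{44}^2+1}{\psi_{41}}$, $\psi_{15}=\psi_{16}=\psi_{25}=\psi_{26}=\psi_{36}=\psi_{45}=\psi_{46}=0$. Consequently, for every such $J$, $(\Omega_{01},J,g_J)$ with $g_J(X,Y)=\Omega_{01}(X,JY)$ is a left-invariant semi-K\"ahler structure on $G_4$ with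 integrable complex structure $J$.
   Context: Left-invariant tensors on a Lie group are identified with their values on the Lie algebra $\mathfrak g$. $e^1,\dots,e^6$ is the dual basis of $e_1,\dots,e_6$, and $e^i\wedge e^j=e^i\otimes e^j-e^j\otimes e^i$. The exterior derivative $d$ is that of left-invariant forms; for a 2-form, $d\omega=0$ means $\omega([X,Y],Z)-\omega([X,Z],Y)+\omega([Y,Z],X)=0$ for all $X,Y,Z\in\mathfrak g$. A left-invariant symplectic structure is a nondegenerate 2-form $\omega$ on $\mathfrak g$ with $d\omega=0$. A left-invariant paracomplex structure is an endomorphism $P$ of $\mathfrak g$ with $P^2=\mathrm{Id}$, whose $(\pm1)$-eigenspaces have equal dimension and are subalgebras. A 2-form $\omega$ is compatible with $P$ if $\omega(PX,PY)=-\omega(X,Y)$ for all $X,Y$. A left-invariant (integrable) complex structure is an endomorphism $J$ of $\mathfrak g$ with $J^2=-\mathrm{Id}$ and $[JX,JY]-[X,Y]-J[JX,Y]-J[X,JY]=0$ for all $X,Y$. A 2-form $\omega$ is compatible with $J$ if $\omega(JX,JY)=\omega(X,Y)$ for all $X,Y$. In dimension 6, a semi-K\"ahler 2-form is a nondegenerate left-invariant 2-form $\omega$ with $d(\omega^2)=0$, equivalently $\omega\wedge d\omega=0$. A left-invariant semi-para-K\"ahler (resp. semi-K\"ahler) structure is a triple $(\omega,P,g)$ (resp. $(\omega,J,g)$) where $P$ is a left-invariant (almost) paracomplex structure (resp. $J$ a left-invariant (almost) complex structure), $\omega$ is a semi-K\"ahler 2-form compatible with it, and $g(X,Y)=\omega(X,PY)$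 (resp. $g(X,Y)=\omega(X,JY)$) is the associated pseudo-Riemannian metric, of any signature. Scalar curvature is that of the Levi-Civita connection of the left-invariant pseudo-Riemannian metric. *)

theory Defs
  imports "HOL-Analysis.Analysis" "HOL-Library.Numeral_Type"
begin

text \<open>
  Left-invariant tensors on a Lie group are represented by their values on its Lie algebra, which is
  given by a bracket \<open>br\<close> on \<open>real^'n\<close>.
\<close>

definition lie_bracket :: "(real^'n \<Rightarrow> real^'n \<Rightarrow> real^'n) \<Rightarrow> bool" where
  "lie_bracket br \<longleftrightarrow> bilinear br \<and> (\<forall>X. br X X = 0) \<and>
     (\<forall>X Y Z. br X (br Y Z) + br Y (br Z X) + br Z (br X Y) = 0)"

definition lie_subalgebra :: "(real^'n \<Rightarrow> real^'n \<Rightarrow> real^'n) \<Rightarrow> (real^'n) set \<Rightarrow> bool" where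
  "lie_subalgebra br S \<longleftrightarrow> subspace S \<and> (\<forall>X\<in>S. \<forall>Y\<in>S. br X Y \<in> S)"


subsection \<open>Left-invariant forms\<close>

text \<open>
  A \<open>k\<close>-form is a real function on lists of \<open>k\<close> vectors; its values on lists of any other length
  are irrelevant.  The normalisation of the wedge product is the one for which
  \<open>\<alpha> \<and> \<beta> = \<alpha> \<otimes> \<beta> - \<beta> \<otimes> \<alpha>\<close> for 1-forms.
\<close>

definition wedge ::
  "nat \<Rightarrow> nat \<Rightarrow> ('v list \<Rightarrow> real) \<Rightarrow> ('v list \<Rightarrow> real) \<Rightarrow> 'v list \<Rightarrow> real" where
  "wedge k l \<alpha> \<beta> Xs =
     (\<Sum>\<sigma> | \<sigma> permutes {..<k + l}. of_int (sign \<sigma>)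
        * \<alpha> (map (\<lambda>i. Xs ! \<sigma> i) [0..<k]) * \<beta> (map (\<lambda>i. Xs ! \<sigma> i) [k..<k + l]))
     / (fact k * fact l)"

text \<open>
  \<open>(d\<alpha>)(X\<^sub>0,\<dots>,X\<^sub>k) = \<Sum>\<^sub>i\<^sub><\<^sub>j (-1)\<^sup>i\<^sup>+\<^sup>j \<alpha>([X\<^sub>i,X\<^sub>j],X\<^sub>0,\<dots>)\<close> with \<open>X\<^sub>i\<close> and \<open>X\<^sub>j\<close> omitted: on left-invariant
  forms the terms of Cartan's formula that differentiate functions vanish.
\<close>

definition ext_deriv ::
  "('v \<Rightarrow> 'v \<Rightarrow> 'v) \<Rightarrow> ('v list \<Rightarrow> real) \<Rightarrow> 'v list \<Rightarrow> real" where
  "ext_deriv br \<alpha> Xs =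
     (\<Sum>i<length Xs. \<Sum>j\<in>{i<..<length Xs}.
        (- 1) ^ (i + j) * \<alpha> (br (Xs ! i) (Xs ! j) # nths Xs (- {i, j})))"

definition two_form :: "(real^'n \<Rightarrow> real^'n \<Rightarrow> real) \<Rightarrow> bool" where
  "two_form \<omega> \<longleftrightarrow> bilinear \<omega> \<and> (\<forall>X. \<omega> X X = 0)"

definition nondegenerate :: "(real^'n \<Rightarrow> real^'n \<Rightarrow> real) \<Rightarrow> bool" where
  "nondegenerate b \<longleftrightarrow> (\<forall>X. (\<forall>Y. b X Y = 0) \<longrightarrow> X = 0)"

definition form2 :: "('v \<Rightarrow> 'v \<Rightarrow> real) \<Rightarrow> 'v list \<Rightarrow> real" where
  "form2 \<omega> Xs = \<omega> (Xs ! 0) (Xs ! 1)"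

lemma ext_deriv_form2:
  "ext_deriv br (form2 \<omega>) [X, Y, Z] = - (\<omega> (br X Y) Z - \<omega> (br X Z) Y + \<omega> (br Y Z) X)"
proof -
  have "{Suc 0<..<3} = {2::nat}" "{0<..<3} = {1, 2::nat}" "{2<..<3} = ({}::nat set)" by auto
  thus ?thesis
    by (simp add: ext_deriv_def form2_def numeral_3_eq_3 nths_Cons numeral_2_eq_2)
qed

definition symplectic ::
  "(real^'n \<Rightarrow> real^'n \<Rightarrow> real^'n) \<Rightarrow> (real^'n \<Rightarrow> real^'n \<Rightarrow> real) \<Rightarrow> bool" where
  "symplectic br \<omega> \<longleftrightarrow> two_form \<omega> \<and> nondegenerate \<omega> \<and>
     (\<forall>X Y Z. ext_deriv br (form2 \<omega>) [X, Y, Z] = 0)"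

text \<open>Dimension 6 only: the condition is \<open>d(\<omega> \<and> \<omega>) = 0\<close>, an equation between 5-forms.\<close>

definition semi_kahler_form ::
  "(real^6 \<Rightarrow> real^6 \<Rightarrow> real^6) \<Rightarrow> (real^6 \<Rightarrow> real^6 \<Rightarrow> real) \<Rightarrow> bool" where
  "semi_kahler_form br \<omega> \<longleftrightarrow> two_form \<omega> \<and> nondegenerate \<omega> \<and>
     (\<forall>Xs. length Xs = 5 \<longrightarrow> ext_deriv br (wedge 2 2 (form2 \<omega>) (form2 \<omega>)) Xs = 0)"


subsection \<open>Paracomplex and complex structures\<close>

definition almost_paracomplex :: "(real^'n \<Rightarrow> real^'n) \<Rightarrow> bool" where
  "almost_paracomplex P \<longleftrightarrow> linear P \<and> (\<forall>X. P (P X) = X) \<and>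
     dim {X. P X = X} = dim {X. P X = - X}"

definition paracomplex ::
  "(real^'n \<Rightarrow> real^'n \<Rightarrow> real^'n) \<Rightarrow> (real^'n \<Rightarrow> real^'n) \<Rightarrow> bool" where
  "paracomplex br P \<longleftrightarrow> almost_paracomplex P \<and>
     lie_subalgebra br {X. P X = X} \<and> lie_subalgebra br {X. P X = - X}"

definition para_compatible ::
  "(real^'n \<Rightarrow> real^'n) \<Rightarrow> (real^'n \<Rightarrow> real^'n \<Rightarrow> real) \<Rightarrow> bool" where
  "para_compatible P \<omega> \<longleftrightarrow> (\<forall>X Y. \<omega> (P X) (P Y) = - \<omega> X Y)"

definition almost_complex :: "(real^'n \<Rightarrow> real^'n) \<Rightarrow> bool" where
  "almost_complex J \<longleftrightarrow> linear J \<and> (\<forall>X. J (J X) = - X)"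

definition integrable_complex ::
  "(real^'n \<Rightarrow> real^'n \<Rightarrow> real^'n) \<Rightarrow> (real^'n \<Rightarrow> real^'n) \<Rightarrow> bool" where
  "integrable_complex br J \<longleftrightarrow> almost_complex J \<and>
     (\<forall>X Y. br (J X) (J Y) - br X Y - J (br (J X) Y) - J (br X (J Y)) = 0)"

definition complex_compatible ::
  "(real^'n \<Rightarrow> real^'n) \<Rightarrow> (real^'n \<Rightarrow> real^'n \<Rightarrow> real) \<Rightarrow> bool" where
  "complex_compatible J \<omega> \<longleftrightarrow> (\<forall>X Y. \<omega> (J X) (J Y) = \<omega> X Y)"

definition pseudo_metric :: "(real^'n \<Rightarrow> real^'n \<Rightarrow> real) \<Rightarrow> bool" where
  "pseudo_metric g \<longleftrightarrow> bilinear g \<and> (\<forall>X Y. g X Y = g Y X) \<and> nondegenerate g"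

definition semi_para_kahler ::
  "(real^6 \<Rightarrow> real^6 \<Rightarrow> real^6) \<Rightarrow> (real^6 \<Rightarrow> real^6 \<Rightarrow> real) \<Rightarrow> (real^6 \<Rightarrow> real^6) \<Rightarrow>
     (real^6 \<Rightarrow> real^6 \<Rightarrow> real) \<Rightarrow> bool" where
  "semi_para_kahler br \<omega> P g \<longleftrightarrow> almost_paracomplex P \<and> semi_kahler_form br \<omega> \<and>
     para_compatible P \<omega> \<and> g = (\<lambda>X Y. \<omega> X (P Y)) \<and> pseudo_metric g"

definition semi_kahler ::
  "(real^6 \<Rightarrow> real^6 \<Rightarrow> real^6) \<Rightarrow> (real^6 \<Rightarrow> real^6 \<Rightarrow> real) \<Rightarrow> (real^6 \<Rightarrow> real^6) \<Rightarrow>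
     (real^6 \<Rightarrow> real^6 \<Rightarrow> real) \<Rightarrow> bool" where
  "semi_kahler br \<omega> J g \<longleftrightarrow> almost_complex J \<and> semi_kahler_form br \<omega> \<and>
     complex_compatible J \<omega> \<and> g = (\<lambda>X Y. \<omega> X (J Y)) \<and> pseudo_metric g"


subsection \<open>Curvature of a left-invariant pseudo-Riemannian metric\<close>

text \<open>
  \<open>nabla X Y\<close> stands for the covariant derivative of \<open>Y\<close> along \<open>X\<close>.  As \<open>g X Y\<close> is constant for
  left-invariant fields, metricity reads \<open>g(\<nabla>\<^sub>X Y, Z) + g(Y, \<nabla>\<^sub>X Z) = 0\<close>.
\<close>

definition is_levi_civita ::
  "(real^'n \<Rightarrow> real^'n \<Rightarrow> real^'n) \<Rightarrow> (real^'n \<Rightarrow> real^'n \<Rightarrow> real) \<Rightarrow>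
     (real^'n \<Rightarrow> real^'n \<Rightarrow> real^'n) \<Rightarrow> bool" where
  "is_levi_civita br g nabla \<longleftrightarrow> bilinear nabla \<and>
     (\<forall>X Y. nabla X Y - nabla Y X = br X Y) \<and>
     (\<forall>X Y Z. g (nabla X Y) Z + g Y (nabla X Z) = 0)"

definition levi_civita ::
  "(real^'n \<Rightarrow> real^'n \<Rightarrow> real^'n) \<Rightarrow> (real^'n \<Rightarrow> real^'n \<Rightarrow> real) \<Rightarrow>
     real^'n \<Rightarrow> real^'n \<Rightarrow> real^'n" where
  "levi_civita br g = (THE nabla. is_levi_civita br g nabla)"

definition riemann ::
  "(real^'n \<Rightarrow> real^'n \<Rightarrow> real^'n) \<Rightarrow> (real^'n \<Rightarrow> real^'n \<Rightarrow> real) \<Rightarrow>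
     real^'n \<Rightarrow> real^'n \<Rightarrow> real^'n \<Rightarrow> real^'n" where
  "riemann br g X Y Z = (let nabla = levi_civita br g in
     nabla X (nabla Y Z) - nabla Y (nabla X Z) - nabla (br X Y) Z)"

definition ricci ::
  "(real^'n \<Rightarrow> real^'n \<Rightarrow> real^'n) \<Rightarrow> (real^'n \<Rightarrow> real^'n \<Rightarrow> real) \<Rightarrow>
     real^'n \<Rightarrow> real^'n \<Rightarrow> real" where
  "ricci br g Y Z = trace (matrix (\<lambda>X. riemann br g X Y Z))"

definition gram :: "(real^'n \<Rightarrow> real^'n \<Rightarrow> real) \<Rightarrow> real^'n^'n" where
  "gram b = (\<chi> i j. b (axis i 1) (axis j 1))"

text \<open>The contraction \<open>g\<^sup>i\<^sup>j Ric\<^sub>i\<^sub>j\<close>.\<close>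

definition scalar_curvature ::
  "(real^'n \<Rightarrow> real^'n \<Rightarrow> real^'n) \<Rightarrow> (real^'n \<Rightarrow> real^'n \<Rightarrow> real) \<Rightarrow> real" where
  "scalar_curvature br g = trace (matrix_inv (gram g) ** gram (ricci br g))"


subsection \<open>The Lie algebra\<close>

text \<open>
  The index type \<open>6\<close> consists of the integers modulo 6, so its six elements are
  \<open>1, \<dots>, 6\<close>, with \<open>6 = 0\<close>.
\<close>

abbreviation e :: "6 \<Rightarrow> real^6" where
  "e i \<equiv> axis i 1"

definition e_dual :: "6 \<Rightarrow> real^6 \<Rightarrow> real" where
  "e_dual i X = X $ i"

definition wedge1 :: "('v \<Rightarrow> real) \<Rightarrow> ('v \<Rightarrow> real) \<Rightarrow> 'v \<Rightarrow> 'v \<Rightarrow> real" where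
  "wedge1 \<alpha> \<beta> X Y = \<alpha> X * \<beta> Y - \<beta> X * \<alpha> Y"

abbreviation ee :: "6 \<Rightarrow> 6 \<Rightarrow> real^6 \<Rightarrow> real^6 \<Rightarrow> real" where
  "ee i j \<equiv> wedge1 (e_dual i) (e_dual j)"

definition g4 :: "real^6 \<Rightarrow> real^6 \<Rightarrow> real^6" where
  "g4 X Y =
     ee 4 5 X Y *\<^sub>R e 6 - ee 4 6 X Y *\<^sub>R e 5 + ee 5 6 X Y *\<^sub>R e 4
     + ee 4 2 X Y *\<^sub>R e 3 - ee 5 1 X Y *\<^sub>R e 3 + ee 6 1 X Y *\<^sub>R e 2
     - ee 4 3 X Y *\<^sub>R e 2 + ee 5 3 X Y *\<^sub>R e 1 - ee 6 2 X Y *\<^sub>R e 1"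

lemma wedge_one_one: "wedge 1 1 (\<lambda>Xs. \<alpha> (Xs ! 0)) (\<lambda>Xs. \<beta> (Xs ! 0)) [X, Y] = wedge1 \<alpha> \<beta> X Y"
proof -
  have 1: "{\<sigma>. \<sigma> permutes {..<1 + 1::nat}} = {id, Transposition.transpose 0 1}"
    using permutes_doubleton_iff[of _ "0::nat" 1] by (auto simp: lessThan_Suc insert_commute)
  have 2: "(id::nat \<Rightarrow> nat) \<noteq> Transposition.transpose 0 1"
    by (metis id_apply transpose_apply_first zero_neq_one)
  show ?thesis
    unfolding wedge_def 1 using 2
    by (simp add: sign_swap_id sign_id wedge1_def mult.commute)
qed

lemma UNIV_six: "(UNIV :: 6 set) = {1, 2, 3, 4, 5, 6}"
proof -
  have "card {1, 2, 3, 4, 5, 6 :: 6} = 6" by simp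
  thus ?thesis by (intro card_subset_eq[symmetric]) auto
qed

lemma forall_six: "(\<forall>i::6. Q i) \<longleftrightarrow> Q 1 \<and> Q 2 \<and> Q 3 \<and> Q 4 \<and> Q 5 \<and> Q 6"
proof -
  have "(\<forall>i::6. Q i) \<longleftrightarrow> (\<forall>i\<in>{1, 2, 3, 4, 5, 6}. Q i)" by (simp only: UNIV_six[symmetric] ball_UNIV)
  thus ?thesis by simp
qed

lemma g4_nonzero_brackets:
  "g4 (e 4) (e 5) = e 6" "g4 (e 4) (e 6) = - e 5" "g4 (e 5) (e 6) = e 4"
  "g4 (e 4) (e 2) = e 3" "g4 (e 5) (e 1) = - e 3" "g4 (e 6) (e 1) = e 2"
  "g4 (e 4) (e 3) = - e 2" "g4 (e 5) (e 3) = e 1" "g4 (e 6) (e 2) = - e 1"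
  by (simp_all add: g4_def wedge1_def e_dual_def axis_def vec_eq_iff)

lemma g4_zero_brackets:
  "g4 (e 1) (e 2) = 0" "g4 (e 1) (e 3) = 0" "g4 (e 2) (e 3) = 0"
  "g4 (e 4) (e 1) = 0" "g4 (e 5) (e 2) = 0" "g4 (e 6) (e 3) = 0"
  by (simp_all add: g4_def wedge1_def e_dual_def axis_def vec_eq_iff)

lemma g4_lie_bracket: "lie_bracket g4"
proof -
  have "bilinear g4"
    unfolding bilinear_def
    by (auto intro!: linearI simp: g4_def wedge1_def e_dual_def algebra_simps vec_eq_iff)
  moreover have "g4 X X = 0" for X
    by (simp add: g4_def wedge1_def)
  moreover have "g4 X (g4 Y Z) + g4 Y (g4 Z X) + g4 Z (g4 X Y) = 0" for X Y Z
    by (simp add: vec_eq_iff forall_six g4_def wedge1_def e_dual_def axis_def algebra_simps)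
  ultimately show ?thesis
    by (simp add: lie_bracket_def)
qed


subsection \<open>The tensors and families of the theorem\<close>

definition P0 :: "real^6 \<Rightarrow> real^6" where
  "P0 X = (\<chi> i. if i \<in> {1, 2, 3} then X $ i else - X $ i)"

definition Omega :: "real \<Rightarrow> real \<Rightarrow> real \<Rightarrow> real^6 \<Rightarrow> real^6 \<Rightarrow> real" where
  "Omega a b c X Y = a * ee 1 4 X Y + b * ee 2 5 X Y + c * ee 3 6 X Y"

definition Omega01 :: "real^6 \<Rightarrow> real^6 \<Rightarrow> real" where
  "Omega01 X Y = - ee 1 4 X Y + ee 2 5 X Y + ee 3 6 X Y"

definition cov456 :: "real \<Rightarrow> real \<Rightarrow> real \<Rightarrow> real^6 \<Rightarrow> real" where
  "cov456 a b c X = a * e_dual 4 X + b * e_dual 5 X + c * e_dual 6 X"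

text \<open>
  Parameters such as \<open>w\<^sub>1\<^sub>4\<close> and \<open>\<psi>\<^sub>1\<^sub>4\<close> are written \<open>w 1 4\<close> and \<open>\<psi> 1 4\<close>; entries that do not
  occur in a formula play no role.
\<close>

definition omega1 :: "(nat \<Rightarrow> nat \<Rightarrow> real) \<Rightarrow> real^6 \<Rightarrow> real^6 \<Rightarrow> real" where
  "omega1 w X Y =
     wedge1 (e_dual 1) (cov456 (w 1 4) (w 2 4) (w 3 4)) X Y
     + wedge1 (e_dual 2) (cov456 (w 2 4) (w 2 5) (w 2 6)) X Y
     + wedge1 (e_dual 3) (cov456 (w 3 4) (w 2 6) (w 3 6)) X Y"

definition omega2 :: "(nat \<Rightarrow> nat \<Rightarrow> real) \<Rightarrow> real^6 \<Rightarrow> real^6 \<Rightarrow> real" where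
  "omega2 w X Y =
     wedge1 (e_dual 1) (cov456 (w 1 4) (w 1 5) (w 3 4)) X Y
     + wedge1 (e_dual 2) (cov456 (w 1 5) (w 2 5) (w 3 5)) X Y
     + wedge1 (e_dual 3) (cov456 (w 3 4) (w 3 5) 0) X Y"

text \<open>The linear map whose values on \<open>e 1, \<dots>, e 6\<close> are the six coefficient vectors below.\<close>

definition J_psi :: "real \<Rightarrow> (nat \<Rightarrow> nat \<Rightarrow> real) \<Rightarrow> real^6 \<Rightarrow> real^6" where
  "J_psi \<epsilon> \<psi> X =
     X $ 1 *\<^sub>R (- \<psi> 4 4 *\<^sub>R e 1 + \<psi> 4 5 *\<^sub>R e 2 + \<psi> 4 6 *\<^sub>R e 3 + \<psi> 4 1 *\<^sub>R e 4)
     + X $ 2 *\<^sub>R (\<epsilon> *\<^sub>R e 3)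
     + X $ 3 *\<^sub>R (- \<epsilon> *\<^sub>R e 2)
     + X $ 4 *\<^sub>R (\<psi> 1 4 *\<^sub>R e 1 - \<psi> 1 5 *\<^sub>R e 2 - \<psi> 1 6 *\<^sub>R e 3 + \<psi> 4 4 *\<^sub>R e 4)
     + X $ 5 *\<^sub>R (\<psi> 1 5 *\<^sub>R e 1 + \<psi> 2 5 *\<^sub>R e 2 + \<psi> 2 6 *\<^sub>R e 3 + \<psi> 4 5 *\<^sub>R e 4 + \<epsilon> *\<^sub>R e 6)
     + X $ 6 *\<^sub>R (\<psi> 1 6 *\<^sub>R e 1 + \<psi> 2 6 *\<^sub>R e 2 + \<psi> 3 6 *\<^sub>R e 3 + \<psi> 4 6 *\<^sub>R e 4 - \<epsilon> *\<^sub>R e 5)"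

definition J_family1 :: "(real^6 \<Rightarrow> real^6) set" where
  "J_family1 = {J_psi 1 \<psi> | \<psi>. \<psi> 4 1 \<noteq> 0 \<and> \<psi> 4 5 \<noteq> 0
     \<and> \<psi> 1 4 = - (((\<psi> 4 5)\<^sup>2 + (\<psi> 4 6)\<^sup>2) / (\<psi> 4 1 * (\<psi> 4 5)\<^sup>2))
     \<and> \<psi> 1 5 = 0
     \<and> \<psi> 1 6 = ((\<psi> 4 5)\<^sup>2 + (\<psi> 4 6)\<^sup>2) / (\<psi> 4 1 * \<psi> 4 5)
     \<and> \<psi> 2 5 = (\<psi> 4 5)\<^sup>2 / \<psi> 4 1
     \<and> \<psi> 2 6 = \<psi> 4 5 * \<psi> 4 6 / \<psi> 4 1
     \<and> \<psi> 3 6 = (\<psi> 4 6)\<^sup>2 / \<psi> 4 1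
     \<and> \<psi> 4 4 = - (\<psi> 4 6 / \<psi> 4 5)}"

definition J_family2 :: "(real^6 \<Rightarrow> real^6) set" where
  "J_family2 = {J_psi 1 \<psi> | \<psi> D. D = \<psi> 4 5 * \<psi> 4 4 + \<psi> 4 6 \<and> \<psi> 1 4 \<noteq> 0 \<and> D \<noteq> 0
     \<and> \<psi> 1 5 = D * \<psi> 1 4 / ((\<psi> 4 4)\<^sup>2 + 1)
     \<and> \<psi> 1 6 = \<psi> 1 5 * (\<psi> 4 6 * \<psi> 4 4 - \<psi> 4 5) / D
     \<and> \<psi> 2 5 = - (\<psi> 1 5 * (\<psi> 4 5)\<^sup>2 / D)
     \<and> \<psi> 2 6 = - (\<psi> 1 5 * \<psi> 4 5 * \<psi> 4 6 / D)
     \<and> \<psi> 3 6 = - (\<psi> 1 5 * (\<psi> 4 6)\<^sup>2 / D)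
     \<and> \<psi> 4 1 = - (D / \<psi> 1 5)}"

definition J_family3 :: "(real^6 \<Rightarrow> real^6) set" where
  "J_family3 = {J_psi (- 1) \<psi> | \<psi>. \<psi> 4 1 \<noteq> 0 \<and> \<psi> 4 6 \<noteq> 0
     \<and> \<psi> 1 4 = - (((\<psi> 1 6)\<^sup>2 * (\<psi> 4 1)\<^sup>2 + (\<psi> 4 6)\<^sup>2) / (\<psi> 4 1 * (\<psi> 4 6)\<^sup>2))
     \<and> \<psi> 1 5 = \<psi> 4 6 / \<psi> 4 1
     \<and> \<psi> 2 5 = 0 \<and> \<psi> 2 6 = 0
     \<and> \<psi> 3 6 = (\<psi> 4 6)\<^sup>2 / \<psi> 4 1
     \<and> \<psi> 4 4 = - (\<psi> 1 6 * \<psi> 4 1 / \<psi> 4 6)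
     \<and> \<psi> 4 5 = 0}"

definition J_family4 :: "(real^6 \<Rightarrow> real^6) set" where
  "J_family4 = {J_psi 1 \<psi> | \<psi>. \<psi> 4 1 \<noteq> 0
     \<and> \<psi> 1 4 = - (((\<psi> 4 4)\<^sup>2 + 1) / \<psi> 4 1)
     \<and> \<psi> 1 5 = 0 \<and> \<psi> 1 6 = 0 \<and> \<psi> 2 5 = 0 \<and> \<psi> 2 6 = 0 \<and> \<psi> 3 6 = 0
     \<and> \<psi> 4 5 = 0 \<and> \<psi> 4 6 = 0}"

definition J_families :: "(real^6 \<Rightarrow> real^6) set" where
  "J_families = J_family1 \<union> J_family2 \<union> J_family3 \<union> J_family4"

end

theory Submission
  imports Defs
begin

text \<open>
  Write \<open>X = (u, v)\<close> with \<open>u\<close> in the abelian ideal \<open>U = \<langle>e\<^sub>1, e\<^sub>2, e\<^sub>3\<rangle>\<close> and \<open>v\<close> in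
  \<open>so(3) = \<langle>e\<^sub>4, e\<^sub>5, e\<^sub>6\<rangle>\<close>; the bracket is
  \<open>[(u, v), (u', v')] = (v \<times> u' - v' \<times> u, v \<times> v')\<close>.  All forms in the theorem are
  \<open>\<omega>(X, X') = S u \<bullet> v' - S u' \<bullet> v\<close> with \<open>S\<close> symmetric, and \<open>d\<omega>\<close> is the cyclic sum of
  \<open>\<plusminus>(tr S - 2 S) u \<bullet> (v' \<times> v'')\<close>.  The obstruction to \<open>\<omega> \<and> d\<omega> = 0\<close> is the commutator of \<open>S\<close> and
  \<open>tr S - 2 S\<close>, which vanishes.

  The map \<open>(u, v) \<mapsto> (-u, v)\<close> is an automorphism of the Lie algebra that carries the metric \<open>g\<close> to
  \<open>-g\<close>, so the scalar curvature equals its own negative.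

  For a complex structure \<open>J\<close> compatible with \<open>\<Omega>\<^sub>0\<^sub>1\<close>, let \<open>C\<close> be the \<open>so(3)\<close>-component of
  \<open>J\<close> on \<open>U\<close>.  The Nijenhuis tensor on \<open>U\<close> and compatibility leave two possibilities: only the
  \<open>(e\<^sub>4, e\<^sub>1)\<close> entry of \<open>C\<close> is nonzero, or \<open>C\<close> lives in the plane of the indices 2, 3 and has rank at
  most 1.  The second one is impossible, as rank 0 would give a complex structure on \<open>U\<close>, and rank 1
  would make \<open>e\<^sub>1\<close> an eigenvector of \<open>J\<close>.  In the first one \<open>J\<close> rotates \<open>\<langle>e\<^sub>2, e\<^sub>3\<rangle>\<close>, and everything
  else is determined by the column \<open>J e\<^sub>1\<close>.
\<close>

subsection \<open>Curvature and anti-isometries\<close>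

lemma linear_eq_axis:
  fixes f h :: "real^'n \<Rightarrow> 'b::real_vector"
  assumes "linear f" "linear h" "\<And>i. f (axis i 1) = h (axis i 1)"
  shows "f = h"
proof (rule linear_eq_stdbasis[OF assms(1,2)])
  show "f b = h b" if b: "b \<in> Basis" for b
    using b assms(3) by (auto simp: Basis_vec_def)
qed

text \<open>Nondegeneracy makes \<open>V \<mapsto> g V\<close> injective, and in finite dimension an
  injective map into the dual is onto. \<open>T\<close> is this map in coordinates.\<close>

lemma linear_functional_repr:
  fixes g :: "real^'n \<Rightarrow> real^'n \<Rightarrow> real"
  assumes g: "bilinear g" "nondegenerate g" and f: "linear f"
  shows "\<exists>V. \<forall>Z. g V Z = f Z"
proof -
  have lin: "linear (g V)" for V
    using g(1) by (simp add: bilinear_def)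
  have eq: "h = f" if "linear h" "\<And>i. h (axis i 1) = f (axis i 1)" for h :: "real^'n \<Rightarrow> real"
    using that f by (intro linear_eq_axis)
  define T where "T V = (\<chi> i. g V (axis i 1))" for V
  have "linear T"
    by (rule linearI) (simp_all add: T_def vec_eq_iff bilinear_ladd[OF g(1)] bilinear_lmul[OF g(1)])
  moreover have "V = 0" if "T V = 0" for V
  proof -
    have "linear (\<lambda>Z. 0 :: real)" by (simp add: linear_zero)
    hence "g V = (\<lambda>Z. 0)"
      using that lin[of V] by (intro linear_eq_axis) (auto simp: T_def vec_eq_iff)
    thus ?thesis using g(2) by (simp add: nondegenerate_def)
  qed
  ultimately have "surj T"
    by (simp add: linear_injective_imp_surjective linear_injective_0)
  then obtain V where "T V = (\<chi> i. f (axis i 1))" by (metis surjD)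
  hence "g V = f" using eq[OF lin] by (simp add: T_def vec_eq_iff)
  thus ?thesis by auto
qed

lemma nondegenerate_cancel:
  assumes "bilinear g" "nondegenerate g" "\<And>Z. g V Z = g W Z"
  shows "V = W"
proof -
  have "\<forall>Z. g (V - W) Z = 0" using assms(3) by (simp add: bilinear_lsub[OF assms(1)])
  hence "V - W = 0" using assms(2) unfolding nondegenerate_def by blast
  thus ?thesis by simp
qed

lemma alternating_anticomm:
  assumes b: "bilinear f" and z: "\<And>X. f X X = 0"
  shows "f Y X = - f X Y"
proof -
  have "f (X + Y) (X + Y) = 0" by (rule z)
  hence "f X X + f X Y + (f Y X + f Y Y) = 0"
    by (simp only: bilinear_ladd[OF b] bilinear_radd[OF b] add_ac)
  hence "f X Y + f Y X = 0" by (simp add: z)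
  thus ?thesis by (simp add: add_eq_0_iff2 add.commute)
qed

section \<open>The Levi-Civita connection\<close>

lemma lie_bracket_anticomm: "lie_bracket br \<Longrightarrow> br Y X = - br X Y"
  by (rule alternating_anticomm) (simp_all add: lie_bracket_def)

text \<open>Koszul formula: in the alternating sum of the three cyclic torsion identities, metricity
  cancels four of the six terms and doubles the remaining one.\<close>

lemma levi_civita_koszul:
  assumes "is_levi_civita br g nabla" "pseudo_metric g"
  shows "2 * g (nabla X Y) Z = g (br X Y) Z - g (br Y Z) X + g (br Z X) Y"
proof -
  have b: "bilinear g" and s: "\<And>X Y. g X Y = g Y X" using assms by (auto simp: pseudo_metric_def)
  have t: "g (nabla X Y) Z - g (nabla Y X) Z = g (br X Y) Z" for X Y Z
    using assms(1) by (simp flip: bilinear_lsub[OF b] add: is_levi_civita_def)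
  have m: "g (nabla X Y) Z = - g (nabla X Z) Y" for X Y Z
    using assms(1) s[of Y "nabla X Z"] by (simp add: is_levi_civita_def add_eq_0_iff2)
  show ?thesis
    using t[of X Y Z] t[of Y Z X] t[of Z X Y] m[of X Y Z] m[of Y Z X] m[of Z X Y] by linarith
qed

lemma levi_civita_unique:
  assumes g: "pseudo_metric g" and n: "is_levi_civita br g n" "is_levi_civita br g n'"
  shows "n = n'"
proof (intro ext)
  fix X Y
  have "g (n X Y) Z = g (n' X Y) Z" for Z
    using levi_civita_koszul[OF n(1) g, of X Y Z] levi_civita_koszul[OF n(2) g, of X Y Z] by simp
  thus "n X Y = n' X Y" using g by (auto simp: pseudo_metric_def intro: nondegenerate_cancel)
qed

text \<open>The Koszul formula serves as definition: its right-hand side \<open>K X Y\<close> is a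
  linear functional, represented by \<open>n X Y\<close>. All properties of \<open>n\<close> are
  then checked after pairing with \<open>g\<close>.\<close>

lemma levi_civita_exists:
  assumes br: "lie_bracket br" and g: "pseudo_metric g"
  shows "\<exists>n. is_levi_civita br g n"
proof -
  have bb: "bilinear br" using br by (simp add: lie_bracket_def)
  have b: "bilinear g" and nd: "nondegenerate g" and s: "\<And>X Y. g X Y = g Y X"
    using g by (auto simp: pseudo_metric_def)
  note bil = bilinear_ladd[OF b] bilinear_radd[OF b] bilinear_lmul[OF b] bilinear_rmul[OF b]
    bilinear_lneg[OF b] bilinear_lsub[OF b]
    bilinear_ladd[OF bb] bilinear_radd[OF bb] bilinear_lmul[OF bb] bilinear_rmul[OF bb]
  define K where "K X Y Z = (g (br X Y) Z - g (br Y Z) X + g (br Z X) Y) / 2" for X Y Z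
  have "linear (K X Y)" for X Y
    by (rule linearI) (simp_all add: K_def bil field_simps)
  hence "\<forall>X Y. \<exists>V. \<forall>Z. g V Z = K X Y Z"
    using linear_functional_repr[OF b nd] by blast
  then obtain n where n: "\<And>X Y Z. g (n X Y) Z = K X Y Z" by metis
  note cancel = nondegenerate_cancel[OF b nd]
  have "bilinear n"
    unfolding bilinear_def
    by (intro conjI allI linearI; rule cancel; simp add: bil n K_def field_simps)
  moreover have "n X Y - n Y X = br X Y" for X Y
  proof (rule cancel)
    show "g (n X Y - n Y X) Z = g (br X Y) Z" for Z
      using lie_bracket_anticomm[OF br, of X Y] lie_bracket_anticomm[OF br, of X Z]
        lie_bracket_anticomm[OF br, of Y Z]
      by (simp add: bil n K_def field_simps)
  qed
  moreover have "g (n X Y) Z + g Y (n X Z) = 0" for X Y Z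
    using lie_bracket_anticomm[OF br, of X Y] lie_bracket_anticomm[OF br, of X Z]
      lie_bracket_anticomm[OF br, of Y Z]
    by (simp add: bil n K_def s[of Y "n X Z"] field_simps)
  ultimately have "is_levi_civita br g n" by (simp add: is_levi_civita_def)
  thus ?thesis by blast
qed

lemma is_levi_civita_levi_civita:
  assumes "lie_bracket br" "pseudo_metric g"
  shows "is_levi_civita br g (levi_civita br g)"
  unfolding levi_civita_def
  using levi_civita_exists[OF assms] levi_civita_unique[OF assms(2)] by (metis theI)

section \<open>Gram matrices and curvature tensors\<close>

lemma bilinear_eq_gram:
  assumes "bilinear b"
  shows "b X Y = X \<bullet> (gram b *v Y)"
proof -
  have "b (\<Sum>i\<in>UNIV. X $ i *\<^sub>R axis i 1) (\<Sum>j\<in>UNIV. Y $ j *\<^sub>R axis j 1)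
      = (\<Sum>i\<in>UNIV. \<Sum>j\<in>UNIV. X $ i * (Y $ j * b (axis i 1) (axis j 1)))"
    using assms by (simp add: bilinear_sum sum.cartesian_product bilinear_lmul bilinear_rmul)
  moreover have ex: "(\<Sum>i\<in>UNIV. X $ i *\<^sub>R axis i 1) = X" for X :: "real^'n"
    using basis_expansion[of X] by (simp add: scalar_mult_eq_scaleR)
  ultimately have "b X Y = (\<Sum>i\<in>UNIV. \<Sum>j\<in>UNIV. X $ i * (Y $ j * b (axis i 1) (axis j 1)))"
    by (simp only: ex)
  thus ?thesis
    by (simp add: inner_vec_def matrix_vector_mult_def gram_def sum_distrib_left mult_ac)
qed

lemma gram_pullback:
  assumes "bilinear b" "linear f"
  shows "gram (\<lambda>X Y. b (f X) (f Y)) = transpose (matrix f) ** gram b ** matrix f"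
proof -
  define \<Phi> where "\<Phi> = matrix f"
  have f: "f X = \<Phi> *v X" for X
    using fun_cong[OF matrix_vector_mul(2)[OF assms(2)]] by (simp add: \<Phi>_def)
  have "b (f (axis i 1)) (f (axis j 1)) = (transpose \<Phi> ** gram b ** \<Phi>) $ i $ j" for i j
  proof -
    have "b (f (axis i 1)) (f (axis j 1)) = (\<Phi> *v axis i 1) \<bullet> (gram b *v (\<Phi> *v axis j 1))"
      by (simp only: bilinear_eq_gram[OF assms(1)] f)
    also have "\<dots> = axis i 1 \<bullet> (transpose \<Phi> *v (gram b *v (\<Phi> *v axis j 1)))"
      using dot_lmul_matrix[of "axis i 1" "transpose \<Phi>"] by simp
    also have "\<dots> = axis i 1 \<bullet> ((transpose \<Phi> ** gram b ** \<Phi>) *v axis j 1)"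
      by (simp only: matrix_vector_mul_assoc matrix_mul_assoc)
    also have "\<dots> = (transpose \<Phi> ** gram b ** \<Phi>) $ i $ j"
      by (simp only: matrix_vector_mult_basis column_def inner_axis') simp
    finally show ?thesis .
  qed
  thus ?thesis by (simp add: gram_def vec_eq_iff \<Phi>_def)
qed

text \<open>\<open>matrix\<close> records values on the basis only, so conjugating inside the trace
  of \<open>ricci\<close> requires linearity.\<close>

lemma riemann_trilinear:
  assumes "lie_bracket br" "pseudo_metric g"
  shows "linear (\<lambda>X. riemann br g X Y Z)" "linear (\<lambda>Y. riemann br g X Y Z)" "linear (riemann br g X Y)"
proof -
  have br: "bilinear br" using assms(1) by (simp add: lie_bracket_def)
  have n: "bilinear (levi_civita br g)"
    using is_levi_civita_levi_civita[OF assms] by (simp add: is_levi_civita_def)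
  note bil = bilinear_ladd[OF br] bilinear_radd[OF br] bilinear_lmul[OF br] bilinear_rmul[OF br]
    bilinear_ladd[OF n] bilinear_radd[OF n] bilinear_lmul[OF n] bilinear_rmul[OF n]
  show "linear (\<lambda>X. riemann br g X Y Z)" "linear (\<lambda>Y. riemann br g X Y Z)" "linear (riemann br g X Y)"
    by (rule linearI; simp add: riemann_def Let_def bil algebra_simps)+
qed

lemma ricci_bilinear:
  assumes "lie_bracket br" "pseudo_metric g"
  shows "bilinear (ricci br g)"
proof -
  have *: "ricci br g Y Z = (\<Sum>i\<in>UNIV. riemann br g (axis i 1) Y Z $ i)" for Y Z
    by (simp add: ricci_def trace_def matrix_def)
  note lin = riemann_trilinear(2,3)[OF assms]
  show ?thesis
    unfolding bilinear_def
    by (intro conjI allI linearI)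
      (simp_all add: * linear_add[OF lin(1)] linear_add[OF lin(2)] linear_scale[OF lin(1)]
        linear_scale[OF lin(2)] sum.distrib sum_distrib_left)
qed

lemma matrix_mult_minus:
  fixes A :: "'a::ring_1^'n^'m"
  shows "(- A) ** B = - (A ** B)" and "A ** (- B) = - (A ** B)"
  by (simp_all add: matrix_matrix_mult_def vec_eq_iff sum_negf)

text \<open>
  The Levi-Civita connection and the Ricci tensor do not change when \<open>g\<close> is replaced by \<open>-g\<close>, whereas
  the scalar curvature changes sign.
\<close>

lemma scalar_curvature_anti_isometry:
  fixes br :: "real^'n \<Rightarrow> real^'n \<Rightarrow> real^'n"
  assumes br: "lie_bracket br" and g: "pseudo_metric g"
    and lin: "linear f" and inv: "\<And>X. f (f X) = X"
    and hom: "\<And>X Y. f (br X Y) = br (f X) (f Y)"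
    and anti: "\<And>X Y. g (f X) (f Y) = - g X Y"
  shows "scalar_curvature br g = 0"
proof -
  define n where "n = levi_civita br g"
  have n: "is_levi_civita br g n"
    unfolding n_def by (rule is_levi_civita_levi_civita[OF br g])
  have nb: "bilinear n" using n by (simp add: is_levi_civita_def)
  have b: "bilinear g" and nd: "nondegenerate g" using g by (auto simp: pseudo_metric_def)
  have anti': "g (f X) Y = - g X (f Y)" for X Y
    using anti[of X "f Y"] by (simp add: inv)
  have anti'': "g X (f Y) = - g (f X) Y" for X Y by (simp add: anti')
  \<comment> \<open>Metricity is homogeneous in \<open>g\<close> and hence insensitive to its sign,
    so the conjugate of \<open>n\<close> by the automorphism \<open>f\<close> is again a Levi-Civita
    connection. Uniqueness makes \<open>n\<close> commute with \<open>f\<close>.\<close>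
  have "is_levi_civita br g (\<lambda>X Y. f (n (f X) (f Y)))"
    unfolding is_levi_civita_def
  proof (intro conjI allI)
    show "bilinear (\<lambda>X Y. f (n (f X) (f Y)))"
      unfolding bilinear_def
      by (intro conjI allI linearI)
        (simp_all add: linear_add[OF lin] linear_scale[OF lin] bilinear_ladd[OF nb] bilinear_radd[OF nb]
          bilinear_lmul[OF nb] bilinear_rmul[OF nb])
    show "f (n (f X) (f Y)) - f (n (f Y) (f X)) = br X Y" for X Y
      using n hom[of "f X" "f Y"]
      by (simp add: is_levi_civita_def inv linear_diff[OF lin, symmetric])
    show "g (f (n (f X) (f Y))) Z + g Y (f (n (f X) (f Z))) = 0" for X Y Z
    proof -
      have "g (n (f X) (f Y)) (f Z) + g (f Y) (n (f X) (f Z)) = 0"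
        using n by (simp add: is_levi_civita_def)
      thus ?thesis by (simp add: anti'[of "n _ _"] anti''[of Y])
    qed
  qed
  hence "(\<lambda>X Y. f (n (f X) (f Y))) = n" by (rule levi_civita_unique[OF g _ n])
  hence "f (n (f (f X)) (f (f Y))) = n (f X) (f Y)" for X Y by metis
  hence nf: "n (f X) (f Y) = f (n X Y)" for X Y by (simp add: inv)
  have R: "riemann br g X (f Y) (f Z) = f (riemann br g (f X) Y Z)" for X Y Z
  proof -
    have "riemann br g (f (f X)) (f Y) (f Z) = f (riemann br g (f X) Y Z)"
      by (simp add: riemann_def Let_def n_def[symmetric] nf hom[symmetric] linear_diff[OF lin])
    thus ?thesis by (simp add: inv)
  qed
  define \<Phi> where "\<Phi> = matrix f"
  have "matrix (f \<circ> f) = mat 1" by (simp add: inv comp_def matrix_def mat_def axis_def vec_eq_iff)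
  hence \<Phi>: "\<Phi> ** \<Phi> = mat 1" by (simp add: \<Phi>_def matrix_compose[OF lin lin])
  hence \<Phi>t: "transpose \<Phi> ** transpose \<Phi> = mat 1"
    by (metis matrix_transpose_mul transpose_mat)
  \<comment> \<open>By \<open>R\<close> the endomorphism whose trace is taken is conjugated by the
    involution \<open>f\<close>, which preserves the trace.\<close>
  have ric: "ricci br g (f Y) (f Z) = ricci br g Y Z" for Y Z
  proof -
    let ?r = "\<lambda>X. riemann br g X Y Z"
    have l: "linear ?r" by (rule riemann_trilinear(1)[OF br g])
    have "(\<lambda>X. riemann br g X (f Y) (f Z)) = f \<circ> (?r \<circ> f)" by (auto simp: R)
    hence "matrix (\<lambda>X. riemann br g X (f Y) (f Z)) = \<Phi> ** (matrix ?r ** \<Phi>)"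
      by (simp add: matrix_compose lin l linear_compose \<Phi>_def)
    thus ?thesis
      unfolding ricci_def by (metis \<Phi> matrix_mul_assoc matrix_mul_rid trace_mul_sym)
  qed
  define G where "G = gram g"
  define R where "R = gram (ricci br g)"
  have "gram (\<lambda>X Y. g (f X) (f Y)) = - G"
    by (simp add: anti gram_def G_def vec_eq_iff)
  hence GF: "transpose \<Phi> ** G ** \<Phi> = - G"
    using gram_pullback[OF b lin] by (simp add: \<Phi>_def G_def)
  have RF: "transpose \<Phi> ** R ** \<Phi> = R"
    using gram_pullback[OF ricci_bilinear[OF br g] lin] unfolding \<Phi>_def R_def ric by (rule sym)
  have "X = 0" if "G *v X = 0" for X
  proof (rule nondegenerate_cancel[OF b nd])
    show "g X Z = g 0 Z" for Z
      using that g bilinear_eq_gram[OF b, of Z X]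
      by (simp add: G_def pseudo_metric_def bilinear_lzero[OF b])
  qed
  hence "invertible G"
    using matrix_left_invertible_ker[of G] by (metis invertible_left_inverse)
  \<comment> \<open>\<open>matrix_inv\<close> is a choice, which is an inverse once one
    exists.\<close>
  hence "G ** matrix_inv G = mat 1 \<and> matrix_inv G ** G = mat 1"
    unfolding invertible_def matrix_inv_def by (rule someI_ex)
  then obtain H where H: "matrix_inv G = H" "G ** H = mat 1" "H ** G = mat 1" by blast
  \<comment> \<open>The inverse Gram matrix transforms contragrediently and inherits the sign from
    \<open>GF\<close>. As \<open>R\<close> is invariant, cyclicity of the trace then yields
    \<open>trace (H ** R) = - trace (H ** R)\<close>.\<close>
  have "\<Phi> ** H ** transpose \<Phi> = - H"
  proof -
    have "transpose \<Phi> ** (transpose \<Phi> ** G ** \<Phi>) = G ** \<Phi>"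
      by (simp only: matrix_mul_assoc \<Phi>t matrix_mul_lid)
    hence "G ** \<Phi> = - (transpose \<Phi> ** G)"
      by (simp only: GF matrix_mult_minus)
    hence "G ** (\<Phi> ** H ** transpose \<Phi>) = - (transpose \<Phi> ** (G ** H) ** transpose \<Phi>)"
      by (simp only: matrix_mult_minus matrix_mul_assoc)
    hence "G ** (\<Phi> ** H ** transpose \<Phi>) = - mat 1"
      by (simp only: H \<Phi>t matrix_mul_rid)
    hence "H ** (G ** (\<Phi> ** H ** transpose \<Phi>)) = H ** - mat 1" by (rule arg_cong)
    thus ?thesis by (simp only: matrix_mul_assoc H matrix_mult_minus matrix_mul_lid matrix_mul_rid)
  qed
  hence "trace (\<Phi> ** H ** transpose \<Phi> ** R) = - trace (H ** R)"
    by (simp only: matrix_mult_minus) (simp add: trace_def sum_negf)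
  moreover have "trace (H ** R) = trace (H ** transpose \<Phi> ** R ** \<Phi>)"
    by (subst (1) RF[symmetric]) (simp only: matrix_mul_assoc)
  moreover have "\<dots> = trace (\<Phi> ** H ** transpose \<Phi> ** R)"
    by (subst trace_mul_sym) (simp only: matrix_mul_assoc)
  ultimately have "trace (H ** R) = - trace (H ** R)" by simp
  thus ?thesis by (simp add: scalar_curvature_def H G_def[symmetric] R_def[symmetric])
qed

subsection \<open>Semi-Kaehler forms\<close>

lemma g4_nth [simp]:
  "g4 X Y $ 1 = X $ 5 * Y $ 3 - X $ 3 * Y $ 5 - X $ 6 * Y $ 2 + X $ 2 * Y $ 6"
  "g4 X Y $ 2 = X $ 6 * Y $ 1 - X $ 1 * Y $ 6 - X $ 4 * Y $ 3 + X $ 3 * Y $ 4"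
  "g4 X Y $ 3 = X $ 4 * Y $ 2 - X $ 2 * Y $ 4 - X $ 5 * Y $ 1 + X $ 1 * Y $ 5"
  "g4 X Y $ 4 = X $ 5 * Y $ 6 - X $ 6 * Y $ 5"
  "g4 X Y $ 5 = X $ 6 * Y $ 4 - X $ 4 * Y $ 6"
  "g4 X Y $ 6 = X $ 4 * Y $ 5 - X $ 5 * Y $ 4"
  by (simp_all add: g4_def wedge1_def e_dual_def axis_def)

text \<open>By skew-symmetry the 24 permutations give each of the three pairings 8 times; dividing
  by \<open>fact 2 * fact 2\<close> leaves the factor 2.\<close>

lemma wedge_2_2:
  assumes "\<And>X Y. \<omega> Y X = - \<omega> X Y"
  shows "wedge 2 2 (form2 \<omega>) (form2 \<omega>) [X, Y, Z, W] =
    2 * (\<omega> X Y * \<omega> Z W - \<omega> X Z * \<omega> Y W + \<omega> X W * \<omega> Y Z)"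
proof -
  have f: "{..<2 + 2 :: nat} = insert 0 (insert 1 (insert 2 {3}))" by auto
  have n: "[0..<2::nat] = [0, 1]" "[2..<2 + 2::nat] = [2, 3]" by (simp_all add: upt_rec)
  show ?thesis
    unfolding wedge_def f n
    apply (simp add: sum_over_permutations_insert sign_compose permutation_swap_id permutation_compose
      sign_swap_id sign_id form2_def transpose_def fact_numeral)
    using assms[of X Y] assms[of X Z] assms[of X W] assms[of Y Z] assms[of Y W] assms[of Z W]
    by (simp add: algebra_simps)
qed

lemma ext_deriv_5:
  "ext_deriv br \<alpha> [V, W, X, Y, Z] =
     - \<alpha> [br V W, X, Y, Z] + \<alpha> [br V X, W, Y, Z] - \<alpha> [br V Y, W, X, Z] + \<alpha> [br V Z, W, X, Y]
     - \<alpha> [br W X, V, Y, Z] + \<alpha> [br W Y, V, X, Z] - \<alpha> [br W Z, V, X, Y]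
     - \<alpha> [br X Y, V, W, Z] + \<alpha> [br X Z, V, W, Y] - \<alpha> [br Y Z, V, W, X]"
proof -
  have "{..<5} = {0, 1, 2, 3, 4::nat}" "{0<..<5} = {1, 2, 3, 4::nat}" "{1<..<5} = {2, 3, 4::nat}"
    "{2<..<5} = {3, 4::nat}" "{3<..<5} = {4::nat}" "{4<..<5} = ({}::nat set)" by auto
  thus ?thesis
    by (simp add: ext_deriv_def nths_Cons numeral_eq_Suc)
qed

lemma omega1_eq:
  "omega1 w X Y =
     (w 1 4 * X $ 1 + w 2 4 * X $ 2 + w 3 4 * X $ 3) * Y $ 4
     + (w 2 4 * X $ 1 + w 2 5 * X $ 2 + w 2 6 * X $ 3) * Y $ 5
     + (w 3 4 * X $ 1 + w 2 6 * X $ 2 + w 3 6 * X $ 3) * Y $ 6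
     - (w 1 4 * Y $ 1 + w 2 4 * Y $ 2 + w 3 4 * Y $ 3) * X $ 4
     - (w 2 4 * Y $ 1 + w 2 5 * Y $ 2 + w 2 6 * Y $ 3) * X $ 5
     - (w 3 4 * Y $ 1 + w 2 6 * Y $ 2 + w 3 6 * Y $ 3) * X $ 6"
  by (simp add: omega1_def wedge1_def e_dual_def cov456_def algebra_simps)

lemma omega1_two_form: "two_form (omega1 w)"
  unfolding two_form_def bilinear_def
  by (intro conjI allI linearI)
    (simp_all add: omega1_eq algebra_simps)

lemma omega1_semi_kahler_form:
  assumes "nondegenerate (omega1 w)"
  shows "semi_kahler_form g4 (omega1 w)"
proof -
  let ?\<omega> = "omega1 w"
  \<comment> \<open>With \<open>u\<close> the ideal component of \<open>X\<close>, the
    \<open>q\<close> are the coordinates of \<open>S u\<close>, \<open>t\<close> is the trace of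
    \<open>S\<close>, and the \<open>p\<close> below are the coordinates of
    \<open>(t - 2 S) u\<close>.\<close>
  define q1 q2 q3 t where "q1 = (\<lambda>X :: real^6. w 1 4 * X $ 1 + w 2 4 * X $ 2 + w 3 4 * X $ 3)"
    and "q2 = (\<lambda>X :: real^6. w 2 4 * X $ 1 + w 2 5 * X $ 2 + w 2 6 * X $ 3)"
    and "q3 = (\<lambda>X :: real^6. w 3 4 * X $ 1 + w 2 6 * X $ 2 + w 3 6 * X $ 3)"
    and "t = w 1 4 + w 2 5 + w 3 6"
  define p1 p2 p3 where "p1 = (\<lambda>X. t * X $ 1 - 2 * q1 X)" and "p2 = (\<lambda>X. t * X $ 2 - 2 * q2 X)"
    and "p3 = (\<lambda>X. t * X $ 3 - 2 * q3 X)"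
  have \<omega>: "?\<omega> X Y = q1 X * Y $ 4 + q2 X * Y $ 5 + q3 X * Y $ 6
      - q1 Y * X $ 4 - q2 Y * X $ 5 - q3 Y * X $ 6" for X Y
    by (simp add: omega1_eq q1_def q2_def q3_def)
  \<comment> \<open>\<open>\<tau>\<close> pairs \<open>p Z\<close> with the cross product of the
    \<open>so(3)\<close>-components of \<open>X\<close> and \<open>Y\<close>;
    \<open>\<omega>\<close> is the antisymmetrisation of \<open>\<kappa>\<close>.\<close>
  define \<tau> where "\<tau> X Y Z = p1 Z * (X $ 5 * Y $ 6 - X $ 6 * Y $ 5)
    + p2 Z * (X $ 6 * Y $ 4 - X $ 4 * Y $ 6) + p3 Z * (X $ 4 * Y $ 5 - X $ 5 * Y $ 4)" for X Y Z :: "real^6"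
  define \<kappa> where "\<kappa> X Y = q1 X * Y $ 4 + q2 X * Y $ 5 + q3 X * Y $ 6" for X and Y :: "real^6"
  have \<omega>\<kappa>: "?\<omega> X Y = \<kappa> X Y - \<kappa> Y X" for X Y by (simp add: \<omega> \<kappa>_def)
  have \<tau>_anti: "\<tau> Y X Z = - \<tau> X Y Z" for X Y Z by (simp add: \<tau>_def algebra_simps)
  \<comment> \<open>\<open>det(x, y, z) q\<close> is the cyclic sum of \<open>(x \<times> y) (z \<bullet> q)\<close>\<close>
  have cramer: "\<tau> X Y W * \<kappa> U Z + \<tau> Y Z W * \<kappa> U X + \<tau> Z X W * \<kappa> U Y =
      (X $ 4 * (Y $ 5 * Z $ 6 - Y $ 6 * Z $ 5) + X $ 5 * (Y $ 6 * Z $ 4 - Y $ 4 * Z $ 6)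
       + X $ 6 * (Y $ 4 * Z $ 5 - Y $ 5 * Z $ 4)) * (p1 W * q1 U + p2 W * q2 U + p3 W * q3 U)" for X Y Z W U
    by (simp add: \<tau>_def \<kappa>_def algebra_simps)
  have d: "?\<omega> (g4 X Y) Z - ?\<omega> (g4 X Z) Y + ?\<omega> (g4 Y Z) X = \<tau> X Y Z + \<tau> Y Z X + \<tau> Z X Y" for X Y Z
    by (simp add: \<omega> \<tau>_def p1_def p2_def p3_def q1_def q2_def q3_def t_def algebra_simps)
  \<comment> \<open>Symmetry holds because \<open>S\<close> and \<open>t - 2 S\<close> are commuting
    symmetric matrices.\<close>
  have pq: "p1 X * q1 Y + p2 X * q2 Y + p3 X * q3 Y = p1 Y * q1 X + p2 Y * q2 X + p3 Y * q3 X" for X Y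
    by (simp add: p1_def p2_def p3_def q1_def q2_def q3_def algebra_simps)
  have anti: "?\<omega> Y X = - ?\<omega> X Y" for X Y by (simp add: \<omega>)
  have "ext_deriv g4 (wedge 2 2 (form2 ?\<omega>) (form2 ?\<omega>)) [V, W, X, Y, Z] = 0" for V W X Y Z
  proof -
    let ?d = "\<lambda>X Y Z. ?\<omega> (g4 X Y) Z - ?\<omega> (g4 X Z) Y + ?\<omega> (g4 Y Z) X"
    let ?C = "\<lambda>X Y Z W U. \<tau> X Y W * \<kappa> U Z + \<tau> Y Z W * \<kappa> U X + \<tau> Z X W * \<kappa> U Y"
    \<comment> \<open>One product for each splitting of the five vectors into three and two.\<close>
    have "ext_deriv g4 (wedge 2 2 (form2 ?\<omega>) (form2 ?\<omega>)) [V, W, X, Y, Z] = - 2 *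
      (?d V W X * ?\<omega> Y Z - ?d V W Y * ?\<omega> X Z + ?d V W Z * ?\<omega> X Y + ?d V X Y * ?\<omega> W Z
       - ?d V X Z * ?\<omega> W Y + ?d V Y Z * ?\<omega> W X - ?d W X Y * ?\<omega> V Z + ?d W X Z * ?\<omega> V Y
       - ?d W Y Z * ?\<omega> V X + ?d X Y Z * ?\<omega> V W)"
      unfolding ext_deriv_5 wedge_2_2[OF anti]
      by (simp add: algebra_simps)
    \<comment> \<open>The 60 products of \<open>\<tau>\<close> and \<open>\<kappa>\<close> are
      regrouped by the two vectors that contribute their ideal components. By \<open>cramer\<close>
      each difference is a determinant times a commutator term, which \<open>pq\<close>
      kills.\<close>
    also have "\<dots> = - 2 * ((?C X Y Z V W - ?C X Y Z W V)
      - (?C W Y Z V X - ?C W Y Z X V)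
      + (?C W X Z V Y - ?C W X Z Y V)
      - (?C W X Y V Z - ?C W X Y Z V)
      + (?C V Y Z W X - ?C V Y Z X W)
      - (?C V X Z W Y - ?C V X Z Y W)
      + (?C V X Y W Z - ?C V X Y Z W)
      + (?C V W Z X Y - ?C V W Z Y X)
      - (?C V W Y X Z - ?C V W Y Z X)
      + (?C V W X Y Z - ?C V W X Z Y))"
      unfolding d unfolding \<omega>\<kappa>
      by (simp add: \<tau>_anti[of V W] \<tau>_anti[of V X] \<tau>_anti[of V Y] \<tau>_anti[of V Z] \<tau>_anti[of W X] \<tau>_anti[of W Y] \<tau>_anti[of W Z] \<tau>_anti[of X Y] \<tau>_anti[of X Z] \<tau>_anti[of Y Z] algebra_simps)
    also have "\<dots> = 0"
      using pq[of V W] pq[of V X] pq[of V Y] pq[of V Z] pq[of W X] pq[of W Y] pq[of W Z]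
        pq[of X Y] pq[of X Z] pq[of Y Z]
      by (simp add: cramer)
    finally show ?thesis .
  qed
  hence "ext_deriv g4 (wedge 2 2 (form2 ?\<omega>) (form2 ?\<omega>)) Xs = 0" if "length Xs = 5" for Xs
    using that by (auto simp: numeral_eq_Suc length_Suc_conv)
  thus ?thesis
    using assms omega1_two_form by (simp add: semi_kahler_form_def)
qed

subsection \<open>The paracomplex structure and its metrics\<close>

lemma P0_nth [simp]:
  "P0 X $ 1 = X $ 1" "P0 X $ 2 = X $ 2" "P0 X $ 3 = X $ 3"
  "P0 X $ 4 = - X $ 4" "P0 X $ 5 = - X $ 5" "P0 X $ 6 = - X $ 6"
  by (simp_all add: P0_def)

lemma linear_P0: "linear P0"
  by (rule linearI) (simp_all add: vec_eq_iff P0_def)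

lemma P0_P0 [simp]: "P0 (P0 X) = X"
  by (simp add: vec_eq_iff forall_six)

lemma paracomplex_P0: "paracomplex g4 P0"
proof -
  have eq: "P0 X = X \<longleftrightarrow> X $ 4 = 0 \<and> X $ 5 = 0 \<and> X $ 6 = 0"
      "P0 X = - X \<longleftrightarrow> X $ 1 = 0 \<and> X $ 2 = 0 \<and> X $ 3 = 0" for X
    by (auto simp: vec_eq_iff forall_six)
  \<comment> \<open>Indices live modulo 6, so adding 3 exchanges 1, 2, 3 with 4, 5, 6, and
    \<open>\<sigma>\<close> exchanges the two eigenspaces.\<close>
  define \<sigma> :: "real^6 \<Rightarrow> real^6" where "\<sigma> X = (\<chi> i. X $ (i + 3))" for X
  have \<sigma>: "\<sigma> X $ 1 = X $ 4" "\<sigma> X $ 2 = X $ 5" "\<sigma> X $ 3 = X $ 6"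
    "\<sigma> X $ 4 = X $ 1" "\<sigma> X $ 5 = X $ 2" "\<sigma> X $ 6 = X $ 3" for X
  proof -
    have n: "(7::6) = 1" "(8::6) = 2" "(9::6) = 3" by simp_all
    show "\<sigma> X $ 1 = X $ 4" "\<sigma> X $ 2 = X $ 5" "\<sigma> X $ 3 = X $ 6"
      "\<sigma> X $ 4 = X $ 1" "\<sigma> X $ 5 = X $ 2" "\<sigma> X $ 6 = X $ 3"
      by (simp_all add: \<sigma>_def n)
  qed
  have \<sigma>\<sigma>: "\<sigma> (\<sigma> X) = X" for X by (simp add: vec_eq_iff forall_six \<sigma>)
  have lin: "linear \<sigma>" by (rule linearI) (simp_all add: \<sigma>_def vec_eq_iff)
  have "\<sigma> ` {X. P0 X = X} = {X. P0 X = - X}"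
  proof
    show "{X. P0 X = - X} \<subseteq> \<sigma> ` {X. P0 X = X}"
    proof
      fix X assume "X \<in> {X. P0 X = - X}"
      hence "\<sigma> X \<in> {X. P0 X = X}" by (simp add: eq \<sigma>)
      thus "X \<in> \<sigma> ` {X. P0 X = X}" by (rule rev_image_eqI) (simp add: \<sigma>\<sigma>)
    qed
  qed (auto simp: eq \<sigma>)
  moreover have "inj_on \<sigma> S" for S using \<sigma>\<sigma> by (rule inj_on_inverseI)
  ultimately have "dim {X. P0 X = X} = dim {X. P0 X = - X}"
    using dim_image_eq[OF lin, of "{X. P0 X = X}"] by simp
  thus ?thesis
    unfolding paracomplex_def almost_paracomplex_def lie_subalgebra_def subspace_def
    by (simp add: linear_P0 eq)
qed

text \<open>\<open>- P0\<close> negates the ideal and fixes \<open>so(3)\<close>. The sign matters: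
  \<open>P0\<close> itself satisfies \<open>P0 (g4 X Y) = - g4 (P0 X) (P0 Y)\<close>.\<close>

lemma P0_anti_automorphism: "- P0 (g4 X Y) = g4 (- P0 X) (- P0 Y)"
  by (simp add: vec_eq_iff forall_six)

lemma omega1_para_compatible: "para_compatible P0 (omega1 w)"
  by (simp add: para_compatible_def omega1_eq algebra_simps)

lemma pseudo_metric_omega1:
  assumes "nondegenerate (omega1 w)"
  shows "pseudo_metric (\<lambda>X Y. omega1 w X (P0 Y))"
proof -
  have "bilinear (\<lambda>X Y. omega1 w X (P0 Y))"
    unfolding bilinear_def
    by (intro conjI allI linearI)
      (simp_all add: linear_add[OF linear_P0] linear_scale[OF linear_P0] omega1_eq algebra_simps)
  moreover have "nondegenerate (\<lambda>X Y. omega1 w X (P0 Y))"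
    unfolding nondegenerate_def
  proof (intro allI impI)
    fix X assume "\<forall>Y. omega1 w X (P0 Y) = 0"
    hence "omega1 w X Y = 0" for Y by (metis P0_P0)
    thus "X = 0" using assms by (simp add: nondegenerate_def)
  qed
  ultimately show ?thesis
    by (simp add: pseudo_metric_def omega1_eq algebra_simps)
qed

lemma omega1_semi_para_kahler:
  assumes "nondegenerate (omega1 w)"
  shows "semi_para_kahler g4 (omega1 w) P0 (\<lambda>X Y. omega1 w X (P0 Y))"
  using paracomplex_P0 assms
  by (simp add: semi_para_kahler_def paracomplex_def omega1_semi_kahler_form omega1_para_compatible
      pseudo_metric_omega1)

text \<open>The metric pairs the ideal with \<open>so(3)\<close> only, so flipping the sign of the
  ideal negates it.\<close>

lemma omega1_scalar_curvature:
  assumes "nondegenerate (omega1 w)"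
  shows "scalar_curvature g4 (\<lambda>X Y. omega1 w X (P0 Y)) = 0"
proof (rule scalar_curvature_anti_isometry[where f = "\<lambda>X. - P0 X"])
  show "linear (\<lambda>X. - P0 X)" by (intro linear_compose_neg linear_P0)
  show "- P0 (- P0 X) = X" for X by (simp add: linear_neg[OF linear_P0])
  show "omega1 w (- P0 X) (P0 (- P0 Y)) = - omega1 w X (P0 Y)" for X Y
    by (simp add: omega1_eq algebra_simps)
qed (simp_all add: g4_lie_bracket pseudo_metric_omega1 assms P0_anti_automorphism)

lemma Omega_eq_omega1:
  "Omega a b c = omega1 (\<lambda>i j. if (i, j) = (1, 4) then a else if (i, j) = (2, 5) then b
     else if (i, j) = (3, 6) then c else 0)"
  by (intro ext) (simp add: Omega_def omega1_eq wedge1_def e_dual_def algebra_simps)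

text \<open>Both families consist of symmetric \<open>S\<close>; here the parameters are renamed and
  the last diagonal entry is 0.\<close>

lemma omega2_eq_omega1:
  "omega2 w = omega1 (\<lambda>i j. if (i, j) = (2, 4) then w 1 5 else if (i, j) = (2, 6) then w 3 5
     else if (i, j) = (3, 6) then 0 else w i j)"
  by (intro ext) (simp add: omega2_def omega1_eq wedge1_def e_dual_def cov456_def algebra_simps)

lemma nondegenerate_Omega:
  assumes "a \<noteq> 0" "b \<noteq> 0" "c \<noteq> 0"
  shows "nondegenerate (Omega a b c)"
  unfolding nondegenerate_def
proof (intro allI impI)
  fix X assume X: "\<forall>Y. Omega a b c X Y = 0"
  show "X = 0"
    using X[rule_format, of "e 1"] X[rule_format, of "e 2"] X[rule_format, of "e 3"]
      X[rule_format, of "e 4"] X[rule_format, of "e 5"] X[rule_format, of "e 6"] assms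
    by (simp add: Omega_def wedge1_def e_dual_def axis_def vec_eq_iff forall_six)
qed

lemma nondegenerate_omega2_ex: "\<exists>w. nondegenerate (omega2 w)"
proof
  \<comment> \<open>\<open>S\<close> is the antidiagonal permutation matrix, invertible with last
    diagonal entry 0.\<close>
  let ?w = "\<lambda>i j :: nat. if (i, j) = (3, 4) \<or> (i, j) = (2, 5) then 1 else 0 :: real"
  show "nondegenerate (omega2 ?w)"
    unfolding nondegenerate_def
  proof (intro allI impI)
    fix X assume X: "\<forall>Y. omega2 ?w X Y = 0"
    show "X = 0"
      using X[rule_format, of "e 1"] X[rule_format, of "e 2"] X[rule_format, of "e 3"]
        X[rule_format, of "e 4"] X[rule_format, of "e 5"] X[rule_format, of "e 6"]
      by (simp add: omega2_def wedge1_def e_dual_def cov456_def axis_def vec_eq_iff forall_six)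
  qed
qed

text \<open>
  Closedness makes \<open>\<omega>\<close> vanish on the abelian ideal \<open>U = \<langle>e\<^sub>1, e\<^sub>2, e\<^sub>3\<rangle>\<close> and makes its matrix between
  \<open>U\<close> and \<open>\<langle>e\<^sub>4, e\<^sub>5, e\<^sub>6\<rangle>\<close> a skew-symmetric matrix of size 3, which is singular.
\<close>

lemma g4_no_symplectic: "\<not> symplectic g4 \<omega>"
proof
  assume "symplectic g4 \<omega>"
  hence b: "bilinear \<omega>" and alt: "\<And>X. \<omega> X X = 0" and nd: "nondegenerate \<omega>"
    and "\<And>X Y Z. - (\<omega> (g4 X Y) Z - \<omega> (g4 X Z) Y + \<omega> (g4 Y Z) X) = 0"
    unfolding symplectic_def two_form_def ext_deriv_form2 by blast+
  hence d: "\<omega> (g4 X Y) Z - \<omega> (g4 X Z) Y + \<omega> (g4 Y Z) X = 0" for X Y Z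
    by (simp only: neg_equal_0_iff_equal)
  have anti: "\<omega> Y X = - \<omega> X Y" for X Y
    by (rule alternating_anticomm[OF b alt])
  note bil = bilinear_lneg[OF b] bilinear_lzero[OF b] g4_nonzero_brackets g4_zero_brackets
  define a where "a i j = \<omega> (e i) (e j)" for i j
  have aa: "a i j = - a j i" for i j unfolding a_def by (rule anti)
  have U: "a 1 2 = 0" "a 1 3 = 0" "a 2 3 = 0"
    using d[of "e 4" "e 1" "e 2"] d[of "e 4" "e 1" "e 3"] d[of "e 5" "e 1" "e 2"]
      aa[of 2 1] aa[of 3 1] aa[of 3 2]
    by (simp_all add: bil flip: a_def)
  have S: "a 1 4 = 0" "a 2 5 = 0" "a 3 6 = 0" "a 2 4 = - a 1 5" "a 3 4 = - a 1 6" "a 3 5 = - a 2 6"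
    using d[of "e 4" "e 5" "e 1"] d[of "e 4" "e 5" "e 2"] d[of "e 4" "e 5" "e 3"]
      d[of "e 4" "e 6" "e 1"] d[of "e 4" "e 6" "e 2"] d[of "e 4" "e 6" "e 3"]
      d[of "e 5" "e 6" "e 1"] d[of "e 5" "e 6" "e 2"] d[of "e 5" "e 6" "e 3"]
      aa[of 4 1] aa[of 4 2] aa[of 4 3] aa[of 5 1] aa[of 5 2] aa[of 5 3] aa[of 6 1] aa[of 6 2] aa[of 6 3]
    by (simp_all add: bil flip: a_def)
  have "a i i = 0" for i by (simp add: a_def alt)
  note entries = this U S aa[of 2 1] aa[of 3 1] aa[of 3 2]
  \<comment> \<open>A skew matrix with upper entries \<open>a 1 5\<close>, \<open>a 1 6\<close>,
    \<open>a 2 6\<close> kills this combination; if all three vanish, \<open>e 1\<close>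
    serves.\<close>
  define V where "V = (if a 2 6 = 0 \<and> a 1 6 = 0 \<and> a 1 5 = 0 then e 1
    else a 2 6 *\<^sub>R e 1 - a 1 6 *\<^sub>R e 2 + a 1 5 *\<^sub>R e 3)"
  have "V \<noteq> 0"
    by (auto simp: V_def vec_eq_iff forall_six axis_def)
  have "\<forall>i. \<omega> V (e i) = 0"
    using entries
    by (simp add: forall_six V_def bil bilinear_ladd[OF b] bilinear_lsub[OF b] bilinear_lmul[OF b]
        flip: a_def)
  hence "\<omega> V (e i) = 0" for i by blast
  hence "\<omega> V = (\<lambda>Y. 0)"
    using b by (intro linear_eq_axis linear_zero) (auto simp: bilinear_def)
  thus False using nd \<open>V \<noteq> 0\<close> by (simp add: nondegenerate_def)
qed

subsection \<open>Complex structures\<close>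

text \<open>Otherwise \<open>\<psi> 1 4\<close> would turn into \<open>\<psi> (Suc 0) 4\<close>.\<close>

declare One_nat_def [simp del]

lemma Omega01_eq: "Omega01 = Omega (- 1) 1 1"
  by (intro ext) (simp add: Omega01_def Omega_def)

text \<open>The differential condition concerns \<open>Omega01\<close> alone, which is an
  \<open>omega1\<close>; \<open>J\<close> only has to yield a metric.\<close>

lemma semi_kahler_Omega01:
  assumes J: "almost_complex J" and comp: "complex_compatible J Omega01"
  shows "semi_kahler g4 Omega01 J (\<lambda>X Y. Omega01 X (J Y))"
proof -
  have nd: "nondegenerate Omega01" by (simp add: Omega01_eq nondegenerate_Omega)
  hence sk: "semi_kahler_form g4 Omega01"
    unfolding Omega01_eq Omega_eq_omega1 by (rule omega1_semi_kahler_form)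
  have lin: "linear J" and JJ: "\<And>X. J (J X) = - X"
    using J by (auto simp: almost_complex_def)
  have b: "bilinear Omega01"
    using sk by (simp add: semi_kahler_form_def two_form_def)
  have anti: "Omega01 Y X = - Omega01 X Y" for X Y
    by (simp add: Omega01_def wedge1_def)
  have "bilinear (\<lambda>X Y. Omega01 X (J Y))"
    unfolding bilinear_def
    by (intro conjI allI linearI)
      (simp_all add: linear_add[OF lin] linear_scale[OF lin] bilinear_ladd[OF b] bilinear_radd[OF b]
        bilinear_lmul[OF b] bilinear_rmul[OF b])
  moreover have "Omega01 X (J Y) = Omega01 Y (J X)" for X Y
  proof -
    have "Omega01 X (J Y) = Omega01 (J X) (J (J Y))"
      using comp by (simp add: complex_compatible_def)
    thus ?thesis by (simp add: JJ bilinear_rneg[OF b] anti[of "J X" Y])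
  qed
  moreover have "nondegenerate (\<lambda>X Y. Omega01 X (J Y))"
    unfolding nondegenerate_def
  proof (intro allI impI)
    fix X assume *: "\<forall>Y. Omega01 X (J Y) = 0"
    have "Omega01 X Y = 0" for Y
      using *[rule_format, of "- J Y"] by (simp add: linear_neg[OF lin] JJ)
    thus "X = 0" using nd by (simp add: nondegenerate_def)
  qed
  ultimately show ?thesis
    using J sk comp by (simp add: semi_kahler_def pseudo_metric_def)
qed

text \<open>The Nijenhuis expression is even in \<open>J\<close>.\<close>

lemma integrable_complex_uminus:
  assumes br: "bilinear br" and J: "integrable_complex br J"
  shows "integrable_complex br (\<lambda>X. - J X)"
proof -
  have lin: "linear J" using J by (simp add: integrable_complex_def almost_complex_def)
  show ?thesis
    using J by (simp add: integrable_complex_def almost_complex_def linear_compose_neg linear_neg[OF lin]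
        bilinear_lneg[OF br] bilinear_rneg[OF br])
qed

lemma complex_compatible_uminus:
  assumes b: "bilinear \<omega>" and J: "complex_compatible J \<omega>"
  shows "complex_compatible (\<lambda>X. - J X) \<omega>"
  using J by (simp add: complex_compatible_def bilinear_lneg[OF b] bilinear_rneg[OF b])

lemma bilinear_zero_axis:
  fixes N :: "real^'n \<Rightarrow> real^'m \<Rightarrow> 'b::real_vector"
  assumes N: "bilinear N" "\<And>i j. N (axis i 1) (axis j 1) = 0"
  shows "N X Y = 0"
proof -
  have "N (axis i 1) = (\<lambda>Y. 0)" for i
    using N by (intro linear_eq_axis linear_zero) (auto simp: bilinear_def)
  hence "(\<lambda>X. N X Y) = (\<lambda>X. 0)"
    using N(1) by (intro linear_eq_axis linear_zero) (auto simp: bilinear_def)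
  thus ?thesis by (rule fun_cong)
qed

lemma e_nth:
  "e 1 $ 1 = 1" "e 1 $ 2 = 0" "e 1 $ 3 = 0" "e 1 $ 4 = 0" "e 1 $ 5 = 0" "e 1 $ 6 = 0"
  "e 2 $ 1 = 0" "e 2 $ 2 = 1" "e 2 $ 3 = 0" "e 2 $ 4 = 0" "e 2 $ 5 = 0" "e 2 $ 6 = 0"
  "e 3 $ 1 = 0" "e 3 $ 2 = 0" "e 3 $ 3 = 1" "e 3 $ 4 = 0" "e 3 $ 5 = 0" "e 3 $ 6 = 0"
  "e 4 $ 1 = 0" "e 4 $ 2 = 0" "e 4 $ 3 = 0" "e 4 $ 4 = 1" "e 4 $ 5 = 0" "e 4 $ 6 = 0"
  "e 5 $ 1 = 0" "e 5 $ 2 = 0" "e 5 $ 3 = 0" "e 5 $ 4 = 0" "e 5 $ 5 = 1" "e 5 $ 6 = 0"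
  "e 6 $ 1 = 0" "e 6 $ 2 = 0" "e 6 $ 3 = 0" "e 6 $ 4 = 0" "e 6 $ 5 = 0" "e 6 $ 6 = 1"
  by (simp_all add: axis_def)

lemma J_psi_nth [simp]:
  "J_psi \<epsilon> \<psi> X $ 1 = - \<psi> 4 4 * X $ 1 + \<psi> 1 4 * X $ 4 + \<psi> 1 5 * X $ 5 + \<psi> 1 6 * X $ 6"
  "J_psi \<epsilon> \<psi> X $ 2 = \<psi> 4 5 * X $ 1 - \<epsilon> * X $ 3 - \<psi> 1 5 * X $ 4 + \<psi> 2 5 * X $ 5 + \<psi> 2 6 * X $ 6"
  "J_psi \<epsilon> \<psi> X $ 3 = \<psi> 4 6 * X $ 1 + \<epsilon> * X $ 2 - \<psi> 1 6 * X $ 4 + \<psi> 2 6 * X $ 5 + \<psi> 3 6 * X $ 6"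
  "J_psi \<epsilon> \<psi> X $ 4 = \<psi> 4 1 * X $ 1 + \<psi> 4 4 * X $ 4 + \<psi> 4 5 * X $ 5 + \<psi> 4 6 * X $ 6"
  "J_psi \<epsilon> \<psi> X $ 5 = - \<epsilon> * X $ 6"
  "J_psi \<epsilon> \<psi> X $ 6 = \<epsilon> * X $ 5"
  by (simp_all add: J_psi_def axis_def)

lemma linear_J_psi: "linear (J_psi \<epsilon> \<psi>)"
  by (rule linearI) (simp_all add: J_psi_def algebra_simps)

lemma uminus_J_psi: "(\<lambda>X. - J_psi \<epsilon> \<psi> X) = J_psi (- \<epsilon>) (\<lambda>i j. - \<psi> i j)"
  by (intro ext) (simp add: vec_eq_iff forall_six)

text \<open>
  The four families are the cases of a single one: for \<open>\<epsilon> = 1\<close> they are separated by whether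
  \<open>\<psi>\<^sub>1\<^sub>5\<close> and \<open>\<psi>\<^sub>4\<^sub>5\<close> vanish, and the sign change of \<open>J\<close> exchanges \<open>\<epsilon> = 1\<close> and \<open>\<epsilon> = -1\<close>.
\<close>

definition admissible :: "real \<Rightarrow> (nat \<Rightarrow> nat \<Rightarrow> real) \<Rightarrow> bool" where
  "admissible \<epsilon> \<psi> \<longleftrightarrow> (\<epsilon> = 1 \<or> \<epsilon> = - 1) \<and> \<psi> 4 1 \<noteq> 0
     \<and> \<psi> 4 1 * \<psi> 1 4 = - ((\<psi> 4 4)\<^sup>2 + 1)
     \<and> \<psi> 4 1 * \<psi> 1 5 = - (\<psi> 4 4 * \<psi> 4 5 + \<epsilon> * \<psi> 4 6)
     \<and> \<psi> 4 1 * \<psi> 1 6 = \<epsilon> * \<psi> 4 5 - \<psi> 4 4 * \<psi> 4 6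
     \<and> \<psi> 4 1 * \<psi> 2 5 = (\<psi> 4 5)\<^sup>2
     \<and> \<psi> 4 1 * \<psi> 2 6 = \<psi> 4 5 * \<psi> 4 6
     \<and> \<psi> 4 1 * \<psi> 3 6 = (\<psi> 4 6)\<^sup>2"

lemma admissible_uminus: "admissible (- \<epsilon>) (\<lambda>i j. - \<psi> i j) \<longleftrightarrow> admissible \<epsilon> \<psi>"
  by (auto simp: admissible_def)

section \<open>The four families and the admissible system\<close>

lemma J_family1_admissible:
  assumes "J \<in> J_family1" shows "\<exists>\<psi>. J = J_psi 1 \<psi> \<and> admissible 1 \<psi>"
proof -
  obtain \<psi> where \<psi>: "J = J_psi 1 \<psi>" "\<psi> 4 1 \<noteq> 0" "\<psi> 4 5 \<noteq> 0"
    "\<psi> 1 4 = - (((\<psi> 4 5)\<^sup>2 + (\<psi> 4 6)\<^sup>2) / (\<psi> 4 1 * (\<psi> 4 5)\<^sup>2))" "\<psi> 1 5 = 0"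
    "\<psi> 1 6 = ((\<psi> 4 5)\<^sup>2 + (\<psi> 4 6)\<^sup>2) / (\<psi> 4 1 * \<psi> 4 5)"
    "\<psi> 2 5 = (\<psi> 4 5)\<^sup>2 / \<psi> 4 1" "\<psi> 2 6 = \<psi> 4 5 * \<psi> 4 6 / \<psi> 4 1" "\<psi> 3 6 = (\<psi> 4 6)\<^sup>2 / \<psi> 4 1"
    "\<psi> 4 4 = - (\<psi> 4 6 / \<psi> 4 5)"
    using assms unfolding J_family1_def by blast
  have "admissible 1 \<psi>"
    using \<psi>(2,3) by (simp add: admissible_def \<psi>(4-)) (simp add: power2_eq_square field_simps)
  thus ?thesis using \<psi>(1) by blast
qed

lemma J_family2_admissible:
  assumes "J \<in> J_family2" shows "\<exists>\<psi>. J = J_psi 1 \<psi> \<and> admissible 1 \<psi>"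
proof -
  obtain \<psi> D where J: "J = J_psi 1 \<psi>" and D: "D = \<psi> 4 5 * \<psi> 4 4 + \<psi> 4 6" "\<psi> 1 4 \<noteq> 0" "D \<noteq> 0"
    and 15: "\<psi> 1 5 = D * \<psi> 1 4 / ((\<psi> 4 4)\<^sup>2 + 1)"
    and 16: "\<psi> 1 6 = \<psi> 1 5 * (\<psi> 4 6 * \<psi> 4 4 - \<psi> 4 5) / D"
    and 25: "\<psi> 2 5 = - (\<psi> 1 5 * (\<psi> 4 5)\<^sup>2 / D)"
    and 26: "\<psi> 2 6 = - (\<psi> 1 5 * \<psi> 4 5 * \<psi> 4 6 / D)"
    and 36: "\<psi> 3 6 = - (\<psi> 1 5 * (\<psi> 4 6)\<^sup>2 / D)"
    and 41: "\<psi> 4 1 = - (D / \<psi> 1 5)"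
    using assms unfolding J_family2_def by blast
  have pos: "(\<psi> 4 4)\<^sup>2 + 1 \<noteq> 0" using zero_le_power2[of "\<psi> 4 4"] by linarith
  have "\<psi> 1 5 \<noteq> 0" using D pos by (simp add: 15)
  hence p: "\<psi> 4 1 \<noteq> 0" "\<psi> 4 1 * \<psi> 1 5 = - D" using D by (simp_all add: 41)
  \<comment> \<open>Substituting \<open>p(2)\<close> and cancelling \<open>D\<close> recovers the
    equation for \<open>\<psi> 1 4\<close>.\<close>
  have "\<psi> 4 1 * \<psi> 1 5 * ((\<psi> 4 4)\<^sup>2 + 1) = \<psi> 4 1 * \<psi> 1 4 * D" using pos by (simp add: 15)
  hence "- D * ((\<psi> 4 4)\<^sup>2 + 1) = \<psi> 4 1 * \<psi> 1 4 * D" by (simp only: p(2))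
  hence "D * (\<psi> 4 1 * \<psi> 1 4 + ((\<psi> 4 4)\<^sup>2 + 1)) = 0" by (simp add: algebra_simps)
  hence "\<psi> 4 1 * \<psi> 1 4 = - ((\<psi> 4 4)\<^sup>2 + 1)" using D(3) by (simp add: add_eq_0_iff2)
  moreover have c: "\<psi> 4 1 * (\<psi> 1 5 * c / D) = - c" for c
  proof -
    have "\<psi> 4 1 * (\<psi> 1 5 * c / D) = \<psi> 4 1 * \<psi> 1 5 * c / D" by simp
    thus ?thesis using D(3) by (simp add: p(2))
  qed
  moreover have "\<psi> 4 1 * \<psi> 1 6 = \<psi> 4 5 - \<psi> 4 4 * \<psi> 4 6" unfolding 16 c by simp
  moreover have "\<psi> 4 1 * \<psi> 2 5 = (\<psi> 4 5)\<^sup>2" unfolding 25 mult_minus_right c by simp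
  moreover have "\<psi> 4 1 * \<psi> 2 6 = \<psi> 4 5 * \<psi> 4 6"
    using c[of "\<psi> 4 5 * \<psi> 4 6"] by (simp add: 26 mult.assoc)
  moreover have "\<psi> 4 1 * \<psi> 3 6 = (\<psi> 4 6)\<^sup>2" unfolding 36 mult_minus_right c by simp
  ultimately show ?thesis
    using J p D(1) by (auto simp: admissible_def intro!: exI[of _ \<psi>])
qed

lemma J_family3_admissible:
  assumes "J \<in> J_family3" shows "\<exists>\<psi>. J = J_psi (- 1) \<psi> \<and> admissible (- 1) \<psi>"
proof -
  obtain \<psi> where \<psi>: "J = J_psi (- 1) \<psi>" "\<psi> 4 1 \<noteq> 0" "\<psi> 4 6 \<noteq> 0"
    "\<psi> 1 4 = - (((\<psi> 1 6)\<^sup>2 * (\<psi> 4 1)\<^sup>2 + (\<psi> 4 6)\<^sup>2) / (\<psi> 4 1 * (\<psi> 4 6)\<^sup>2))"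
    "\<psi> 1 5 = \<psi> 4 6 / \<psi> 4 1" "\<psi> 2 5 = 0" "\<psi> 2 6 = 0" "\<psi> 3 6 = (\<psi> 4 6)\<^sup>2 / \<psi> 4 1"
    "\<psi> 4 4 = - (\<psi> 1 6 * \<psi> 4 1 / \<psi> 4 6)" "\<psi> 4 5 = 0"
    using assms unfolding J_family3_def by blast
  have "admissible (- 1) \<psi>"
    using \<psi>(2,3) by (simp add: admissible_def \<psi>(4-)) (simp add: power2_eq_square field_simps)
  thus ?thesis using \<psi>(1) by blast
qed

lemma J_family4_admissible:
  assumes "J \<in> J_family4" shows "\<exists>\<psi>. J = J_psi 1 \<psi> \<and> admissible 1 \<psi>"
proof -
  obtain \<psi> where \<psi>: "J = J_psi 1 \<psi>" "\<psi> 4 1 \<noteq> 0" "\<psi> 1 4 = - (((\<psi> 4 4)\<^sup>2 + 1) / \<psi> 4 1)"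
    "\<psi> 1 5 = 0" "\<psi> 1 6 = 0" "\<psi> 2 5 = 0" "\<psi> 2 6 = 0" "\<psi> 3 6 = 0" "\<psi> 4 5 = 0" "\<psi> 4 6 = 0"
    using assms unfolding J_family4_def by blast
  have "admissible 1 \<psi>"
    using \<psi>(2) by (simp add: admissible_def \<psi>(3-))
  thus ?thesis using \<psi>(1) by blast
qed

lemma admissible_J_families:
  assumes "admissible 1 \<psi>" shows "J_psi 1 \<psi> \<in> J_families"
proof -
  let ?D = "\<psi> 4 5 * \<psi> 4 4 + \<psi> 4 6"
  have p: "\<psi> 4 1 \<noteq> 0"
    and "\<psi> 4 1 * \<psi> 1 4 = - ((\<psi> 4 4)\<^sup>2 + 1)" "\<psi> 4 1 * \<psi> 1 5 = - ?D"
    "\<psi> 4 1 * \<psi> 1 6 = \<psi> 4 5 - \<psi> 4 4 * \<psi> 4 6" "\<psi> 4 1 * \<psi> 2 5 = (\<psi> 4 5)\<^sup>2"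
    "\<psi> 4 1 * \<psi> 2 6 = \<psi> 4 5 * \<psi> 4 6" "\<psi> 4 1 * \<psi> 3 6 = (\<psi> 4 6)\<^sup>2"
    using assms by (auto simp: admissible_def)
  hence \<psi>: "\<psi> 1 4 = - ((\<psi> 4 4)\<^sup>2 + 1) / \<psi> 4 1" "\<psi> 1 5 = - ?D / \<psi> 4 1"
    "\<psi> 1 6 = (\<psi> 4 5 - \<psi> 4 4 * \<psi> 4 6) / \<psi> 4 1" "\<psi> 2 5 = (\<psi> 4 5)\<^sup>2 / \<psi> 4 1"
    "\<psi> 2 6 = \<psi> 4 5 * \<psi> 4 6 / \<psi> 4 1" "\<psi> 3 6 = (\<psi> 4 6)\<^sup>2 / \<psi> 4 1"
    by (simp_all add: eq_divide_eq mult.commute)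
  have pos: "(\<psi> 4 4)\<^sup>2 + 1 \<noteq> 0" using zero_le_power2[of "\<psi> 4 4"] by linarith
  \<comment> \<open>The cases lead to families 2, 1 and 4. They are exhaustive since
    \<open>?D\<close> reduces to \<open>\<psi> 4 6\<close> when
    \<open>\<psi> 4 5 = 0\<close>.\<close>
  consider "?D \<noteq> 0" | "?D = 0" "\<psi> 4 5 \<noteq> 0" | "\<psi> 4 5 = 0" "\<psi> 4 6 = 0" by fastforce
  thus ?thesis
  proof cases
    case 1
    define D where "D = ?D"
    have D: "\<psi> 1 5 = - D / \<psi> 4 1" "D \<noteq> 0" using 1 \<psi>(2) by (simp_all add: D_def)
    have k: "\<psi> 1 5 * c / D = - c / \<psi> 4 1" for c using D by simp
    have "\<psi> 1 5 = D * \<psi> 1 4 / ((\<psi> 4 4)\<^sup>2 + 1)"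
      unfolding D(1) \<psi>(1) times_divide_eq_right mult_minus_right using pos by (simp del: minus_add_distrib)
    moreover have "\<psi> 1 6 = \<psi> 1 5 * (\<psi> 4 6 * \<psi> 4 4 - \<psi> 4 5) / D"
      unfolding k \<psi>(3) by (simp add: mult.commute)
    moreover have "\<psi> 2 5 = - (\<psi> 1 5 * (\<psi> 4 5)\<^sup>2 / D)" unfolding k \<psi>(4) by simp
    moreover have "\<psi> 2 6 = - (\<psi> 1 5 * \<psi> 4 5 * \<psi> 4 6 / D)" unfolding mult.assoc k \<psi>(5) by simp
    moreover have "\<psi> 3 6 = - (\<psi> 1 5 * (\<psi> 4 6)\<^sup>2 / D)" unfolding k \<psi>(6) by simp
    moreover have "\<psi> 4 1 = - (D / \<psi> 1 5)" using D p by simp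
    moreover have "\<psi> 1 4 \<noteq> 0" using p pos by (simp add: \<psi>(1) add_eq_0_iff2)
    ultimately have "J_psi 1 \<psi> \<in> J_family2"
      unfolding J_family2_def using D(2) D_def by blast
    thus ?thesis by (simp add: J_families_def)
  next
    case 2
    hence 44: "\<psi> 4 4 = - (\<psi> 4 6 / \<psi> 4 5)" by (simp add: field_simps add_eq_0_iff)
    have "J_psi 1 \<psi> \<in> J_family1"
      unfolding J_family1_def mem_Collect_eq
      using 2 p by (intro exI[of _ \<psi>]) (simp add: \<psi> 44 power2_eq_square field_simps)
    thus ?thesis by (simp add: J_families_def)
  next
    case 3
    hence "J_psi 1 \<psi> \<in> J_family4"
      unfolding J_family4_def mem_Collect_eq
      using p by (intro exI[of _ \<psi>]) (simp add: \<psi> del: minus_add_distrib)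
    thus ?thesis by (simp add: J_families_def)
  qed
qed

lemma admissible_integrable:
  assumes "admissible \<epsilon> \<psi>"
  shows "integrable_complex g4 (J_psi \<epsilon> \<psi>)" and "complex_compatible (J_psi \<epsilon> \<psi>) Omega01"
proof -
  let ?J = "J_psi \<epsilon> \<psi>"
  have p: "\<psi> 4 1 \<noteq> 0" and \<epsilon>: "\<epsilon> * \<epsilon> = 1" using assms by (auto simp: admissible_def)
  have \<epsilon>': "\<epsilon> * (\<epsilon> * x) = x" for x by (simp flip: mult.assoc add: \<epsilon>)
  \<comment> \<open>Scaling by \<open>\<psi> 4 1\<close> removes all denominators: what remains are
    polynomial identities modulo \<open>\<epsilon> * \<epsilon> = 1\<close> and the relation
    \<open>p14\<close>.\<close>
  define \<beta> \<gamma> where "\<beta> = \<psi> 4 5 / \<psi> 4 1" and "\<gamma> = \<psi> 4 6 / \<psi> 4 1"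
  have 45: "\<psi> 4 5 = \<psi> 4 1 * \<beta>" "\<psi> 4 6 = \<psi> 4 1 * \<gamma>" using p by (simp_all add: \<beta>_def \<gamma>_def)
  have \<psi>: "\<psi> 1 5 = - (\<psi> 4 4 * \<beta> + \<epsilon> * \<gamma>)"
    "\<psi> 1 6 = \<epsilon> * \<beta> - \<psi> 4 4 * \<gamma>" "\<psi> 2 5 = \<psi> 4 1 * \<beta>\<^sup>2" "\<psi> 2 6 = \<psi> 4 1 * \<beta> * \<gamma>" "\<psi> 3 6 = \<psi> 4 1 * \<gamma>\<^sup>2"
    by (rule mult_left_cancel[THEN iffD1, OF p],
      use assms in \<open>simp add: admissible_def 45 power2_eq_square algebra_simps\<close>)+
  have p14: "\<psi> 4 1 * \<psi> 1 4 = - (\<psi> 4 4 * \<psi> 4 4 + 1)"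
    using assms by (simp add: admissible_def power2_eq_square)
  have p14': "\<psi> 4 1 * (\<psi> 1 4 * x) = - (\<psi> 4 4 * \<psi> 4 4 + 1) * x" for x
    by (simp only: mult.assoc[symmetric] p14)
  note p14 = p14 p14' p14[unfolded mult.commute[of "\<psi> 4 1"]]
    p14'[unfolded mult.left_commute[of "\<psi> 4 1"]]
  have JJ: "?J (?J X) = - X" for X
    by (simp add: vec_eq_iff forall_six \<psi> 45 p14 \<epsilon> \<epsilon>' power2_eq_square algebra_simps)
  have comp: "Omega01 (?J X) (?J Y) = Omega01 X Y" for X Y
    by (simp add: Omega01_def wedge1_def e_dual_def \<psi> 45 p14 \<epsilon> \<epsilon>' power2_eq_square algebra_simps)
  show "complex_compatible ?J Omega01" using comp by (simp add: complex_compatible_def)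
  let ?N = "\<lambda>X Y. g4 (?J X) (?J Y) - g4 X Y - ?J (g4 (?J X) Y) - ?J (g4 X (?J Y))"
  have b: "bilinear g4" using g4_lie_bracket by (simp add: lie_bracket_def)
  have N: "bilinear ?N"
    unfolding bilinear_def
    by (intro conjI allI linearI)
      (simp_all add: linear_add[OF linear_J_psi] linear_scale[OF linear_J_psi] bilinear_ladd[OF b]
        bilinear_radd[OF b] bilinear_lmul[OF b] bilinear_rmul[OF b] algebra_simps)
  have "\<forall>i j. ?N (e i) (e j) = 0"
    unfolding forall_six
    by (intro conjI; simp add: vec_eq_iff forall_six e_nth;
        simp add: \<psi> 45 p14 \<epsilon> \<epsilon>' power2_eq_square algebra_simps)
  hence "?N X Y = 0" for X Y using bilinear_zero_axis[OF N] by blast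
  thus "integrable_complex g4 ?J"
    using linear_J_psi JJ by (simp add: integrable_complex_def almost_complex_def)
qed

section \<open>Classification of the compatible complex structures\<close>

lemma sum_six: "sum f (UNIV :: 6 set) = f 1 + f 2 + f 3 + f 4 + f 5 + f 6"
  unfolding UNIV_six by (simp add: add.assoc)

text \<open>In odd size \<open>- mat 1\<close> has determinant -1, which is not a real
  square.\<close>

lemma real_matrix3_square_neq_minus_id:
  fixes A :: "real^3^3"
  shows "A ** A \<noteq> - mat 1"
proof
  assume "A ** A = - mat 1"
  hence "det A * det A = det (- mat 1 :: real^3^3)" by (metis det_mul)
  also have "\<dots> = - 1" by (simp add: det_3 mat_def)
  finally show False using zero_le_square[of "det A"] by linarith
qed

lemma integrable_compatible_admissible:
  assumes J: "integrable_complex g4 J" and comp: "complex_compatible J Omega01"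
  shows "\<exists>\<epsilon> \<psi>. J = J_psi \<epsilon> \<psi> \<and> admissible \<epsilon> \<psi>"
proof -
  have lin: "linear J" and JJ: "\<And>X. J (J X) = - X"
    and N: "\<And>X Y. g4 (J X) (J Y) - g4 X Y - J (g4 (J X) Y) - J (g4 X (J Y)) = 0"
    using J by (auto simp: integrable_complex_def almost_complex_def)
  define m where "m i j = J (e j) $ i" for i j
  have Jn: "J X $ i = m i 1 * X $ 1 + m i 2 * X $ 2 + m i 3 * X $ 3
      + m i 4 * X $ 4 + m i 5 * X $ 5 + m i 6 * X $ 6" for X i
  proof -
    have "(\<Sum>j\<in>UNIV. X $ j *\<^sub>R e j) = X"
      using basis_expansion[of X] by (simp only: scalar_mult_eq_scaleR)
    hence "J X = J (\<Sum>j\<in>UNIV. X $ j *\<^sub>R e j)" by (simp only:)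
    also have "\<dots> = (\<Sum>j\<in>UNIV. X $ j *\<^sub>R J (e j))"
      by (simp add: linear_sum[OF lin] linear_scale[OF lin])
    finally have "J X $ i = (\<Sum>j\<in>UNIV. m i j * X $ j)"
      by (simp only: sum_component) (simp add: m_def mult.commute)
    thus ?thesis by (simp only: sum_six add.assoc)
  qed
  have Je: "J (e j) $ i = m i j" for i j by (simp add: m_def)
  have \<Omega>: "Omega01 (J X) Y = - Omega01 X (J Y)" for X Y
  proof -
    have "Omega01 (J X) (J (J Y)) = Omega01 X (J Y)" using comp by (simp add: complex_compatible_def)
    thus ?thesis by (simp add: JJ Omega01_def wedge1_def e_dual_def algebra_simps)
  qed
  \<comment> \<open>\<open>J\<close> is skew for \<open>Omega01\<close>. This constrains the blocks
    \<open>C\<close> from the ideal to \<open>so(3)\<close> and \<open>B\<close> back, and expresses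
    the block \<open>E\<close> on \<open>so(3)\<close> by the one on the ideal.\<close>
  have C: "m 5 1 = - m 4 2" "m 6 1 = - m 4 3" "m 6 2 = m 5 3"
    using \<Omega>[of "e 1" "e 2"] \<Omega>[of "e 1" "e 3"] \<Omega>[of "e 2" "e 3"]
    by (simp_all add: Omega01_def wedge1_def e_dual_def Je e_nth)
  have B: "m 2 4 = - m 1 5" "m 3 4 = - m 1 6" "m 3 5 = m 2 6"
    using \<Omega>[of "e 4" "e 5"] \<Omega>[of "e 4" "e 6"] \<Omega>[of "e 5" "e 6"]
    by (simp_all add: Omega01_def wedge1_def e_dual_def Je e_nth)
  have E: "m 4 4 = - m 1 1" "m 4 5 = m 2 1" "m 4 6 = m 3 1" "m 5 4 = m 1 2" "m 5 5 = - m 2 2"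
    "m 5 6 = - m 3 2" "m 6 4 = m 1 3" "m 6 5 = - m 2 3" "m 6 6 = - m 3 3"
    using \<Omega>[of "e 1" "e 4"] \<Omega>[of "e 1" "e 5"] \<Omega>[of "e 1" "e 6"]
      \<Omega>[of "e 2" "e 4"] \<Omega>[of "e 2" "e 5"] \<Omega>[of "e 2" "e 6"]
      \<Omega>[of "e 3" "e 4"] \<Omega>[of "e 3" "e 5"] \<Omega>[of "e 3" "e 6"]
    by (simp_all add: Omega01_def wedge1_def e_dual_def Je e_nth)
  note rel = C B E
  have Nn: "(g4 (J X) (J Y) - g4 X Y - J (g4 (J X) Y) - J (g4 X (J Y))) $ i = 0" for X Y i
    by (simp only: N zero_index)
  have JJn: "J (J X) $ i = - X $ i" for X i by (simp add: JJ)
  let ?p = "m 4 1" and ?q = "m 4 2" and ?r = "m 4 3" and ?s = "m 5 2" and ?t = "m 5 3" and ?z = "m 6 3"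
  \<comment> \<open>The rows of \<open>C\<close> are \<open>(p, q, r)\<close>,
    \<open>(-q, s, t)\<close>, \<open>(-r, t, z)\<close>. On the ideal, the
    \<open>so(3)\<close>-part of the Nijenhuis condition says that the cofactor matrix of
    \<open>C\<close> is \<open>C (tr C - C^T)\<close>; \<open>off\<close> and \<open>diag\<close>
    are its entries.\<close>
  have off: "?p * ?q = 0" "?p * ?r = 0" "?p * ?t = 0"
    using Nn[of "e 2" "e 3" 4] Nn[of "e 3" "e 1" 4] Nn[of "e 1" "e 2" 4]
      Nn[of "e 2" "e 3" 5] Nn[of "e 3" "e 1" 5] Nn[of "e 1" "e 2" 5]
      Nn[of "e 2" "e 3" 6] Nn[of "e 3" "e 1" 6] Nn[of "e 1" "e 2" 6]
    by (simp_all add: Jn e_nth rel algebra_simps)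
  have diag: "?s * ?z - ?t * ?t = ?p * (?s + ?z) - ?q * ?q - ?r * ?r"
    "?p * ?z + ?r * ?r = ?s * (?p + ?z) - ?q * ?q - ?t * ?t"
    "?p * ?s + ?q * ?q = ?z * (?p + ?s) - ?r * ?r - ?t * ?t"
    using Nn[of "e 2" "e 3" 4] Nn[of "e 3" "e 1" 5] Nn[of "e 1" "e 2" 6]
    by (simp_all add: Jn e_nth rel algebra_simps)
  have p: "?p \<noteq> 0"
  proof
    assume p0: "?p = 0"
    have "?q * ?q + ?r * ?r = 0" using diag(1,2) unfolding p0 by (simp add: mult.commute)
    hence q0: "?q = 0" "?r = 0" by (simp_all add: sum_squares_eq_zero_iff)
    have st: "?s * ?z = ?t * ?t" using diag(1) unfolding p0 q0 by simp
    note z = p0 q0 rel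
    have 1: "?s * m 2 1 + ?t * m 3 1 = 0" "?t * m 2 1 + ?z * m 3 1 = 0"
      using JJn[of "e 1" 5] JJn[of "e 1" 6] by (simp_all add: Jn e_nth z)
    \<comment> \<open>By \<open>1\<close> the vector \<open>(m 2 1, m 3 1)\<close> is orthogonal to
      the rows \<open>(s, t)\<close> and \<open>(t, z)\<close>, and by \<open>2\<close> it is
      parallel to them; so it vanishes as soon as one row is nonzero.\<close>
    have 2: "?s * m 3 1 = ?t * m 2 1" "?t * m 3 1 = ?z * m 2 1"
      using Nn[of "e 1" "e 2" 1] Nn[of "e 1" "e 3" 1] Nn[of "e 1" "e 4" 5] Nn[of "e 1" "e 4" 6]
      by (simp_all add: Jn e_nth z algebra_simps)
    have 11: "m 1 1 * m 1 1 + m 1 2 * m 2 1 + m 1 3 * m 3 1 = - 1"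
      using JJn[of "e 1" 1] by (simp add: Jn e_nth z)
    show False
    proof (cases "?s = 0 \<and> ?z = 0")
      case True
      hence "?t = 0" using st by simp
      define A :: "real^3^3" where "A = vector [vector [m 1 1, m 1 2, m 1 3],
        vector [m 2 1, m 2 2, m 2 3], vector [m 3 1, m 3 2, m 3 3]]"
      have "A ** A = - mat 1"
        using JJn[of "e 1" 1] JJn[of "e 1" 2] JJn[of "e 1" 3] JJn[of "e 2" 1] JJn[of "e 2" 2]
          JJn[of "e 2" 3] JJn[of "e 3" 1] JJn[of "e 3" 2] JJn[of "e 3" 3] True \<open>?t = 0\<close>
        by (simp add: A_def vec_eq_iff forall_3 matrix_matrix_mult_def sum_3 mat_def Jn e_nth z
            mult.commute)
      thus False using real_matrix3_square_neq_minus_id by blast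
    next
      case False
      have "(?s * ?s + ?t * ?t) * m 3 1 = ?t * (?s * m 2 1 + ?t * m 3 1) + ?s * (?s * m 3 1 - ?t * m 2 1)"
        "(?s * ?s + ?t * ?t) * m 2 1 = ?s * (?s * m 2 1 + ?t * m 3 1) - ?t * (?s * m 3 1 - ?t * m 2 1)"
        "(?z * ?z + ?t * ?t) * m 3 1 = ?z * (?t * m 2 1 + ?z * m 3 1) + ?t * (?t * m 3 1 - ?z * m 2 1)"
        "(?z * ?z + ?t * ?t) * m 2 1 = ?t * (?t * m 2 1 + ?z * m 3 1) - ?z * (?t * m 3 1 - ?z * m 2 1)"
        by (simp_all add: algebra_simps)
      hence "m 3 1 = 0" "m 2 1 = 0"
        using False 1 2 by (auto simp: sum_squares_eq_zero_iff)
      thus False using 11 zero_le_square[of "m 1 1"] by simp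
    qed
  qed
  have 0: "?q = 0" "?r = 0" "?t = 0" using off p by auto
  have "?p * ?s = 0" "?p * ?z = 0" using diag unfolding 0 by (auto simp: algebra_simps)
  hence sz: "?s = 0" "?z = 0" using p by auto
  have A0: "m 1 2 = 0" "m 1 3 = 0"
    using JJn[of "e 2" 4] JJn[of "e 3" 4] p by (simp_all add: Jn e_nth rel 0 sz)
  have rot: "m 3 3 = m 2 2" "m 2 3 = - m 3 2"
    using Nn[of "e 2" "e 1" 2] Nn[of "e 2" "e 1" 3] p
    by (simp_all add: Jn e_nth rel 0 sz A0 add_eq_0_iff flip: distrib_right)
  \<comment> \<open>By \<open>rot\<close>, \<open>J\<close> acts on the plane of \<open>e 2\<close>,
    \<open>e 3\<close> as a complex number; its square is -1, so it is \<open>i\<close> or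
    \<open>-i\<close>.\<close>
  have sq: "m 2 2 * m 2 2 - m 3 2 * m 3 2 = - 1" "m 2 2 * m 3 2 = 0"
    using JJn[of "e 2" 2] JJn[of "e 2" 3] by (simp_all add: Jn e_nth rel 0 sz A0 rot)
  have "m 3 2 \<noteq> 0"
  proof
    assume "m 3 2 = 0"
    hence "m 2 2 * m 2 2 = - 1" using sq(1) by simp
    thus False using zero_le_square[of "m 2 2"] by linarith
  qed
  hence "m 2 2 = 0" using sq(2) by simp
  hence "m 3 2 * m 3 2 = 1" using sq(1) by simp
  hence \<epsilon>: "m 3 2 = 1 \<or> m 3 2 = - 1" by (simp add: square_eq_1_iff)
  note z = rel 0 sz A0 rot \<open>m 2 2 = 0\<close>
  define \<psi> where "\<psi> i j = m (of_nat i) (of_nat j)" for i j :: nat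
  have \<psi>: "\<psi> 1 4 = m 1 4" "\<psi> 1 5 = m 1 5" "\<psi> 1 6 = m 1 6" "\<psi> 2 5 = m 2 5" "\<psi> 2 6 = m 2 6"
    "\<psi> 3 6 = m 3 6" "\<psi> 4 1 = m 4 1" "\<psi> 4 4 = m 4 4" "\<psi> 4 5 = m 4 5" "\<psi> 4 6 = m 4 6"
    by (simp_all add: \<psi>_def)
  have "J = J_psi (m 3 2) \<psi>"
    by (intro ext) (simp add: vec_eq_iff forall_six Jn \<psi> z)
  moreover have "admissible (m 3 2) \<psi>"
  proof -
    have "?p * m 1 4 = - (m 1 1 * m 1 1 + 1)"
      "?p * m 1 5 = m 1 1 * m 2 1 - m 3 2 * m 3 1" "?p * m 1 6 = m 3 2 * m 2 1 + m 1 1 * m 3 1"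
      using JJn[of "e 1" 1] JJn[of "e 1" 2] JJn[of "e 1" 3] by (simp_all add: Jn e_nth z algebra_simps)
    \<comment> \<open>The Nijenhuis tensor gives the difference of \<open>m 2 5\<close> and
      \<open>m 3 6\<close>; their sum comes from \<open>J (J (e 5)) = - e 5\<close>.\<close>
    moreover have "?p * m 2 6 = m 2 1 * m 3 1" "?p * m 2 5 - ?p * m 3 6 = m 2 1 * m 2 1 - m 3 1 * m 3 1"
      using Nn[of "e 1" "e 5" 2] Nn[of "e 1" "e 5" 3] \<epsilon> by (auto simp: Jn e_nth z algebra_simps)
    moreover have "?p * m 2 5 + ?p * m 3 6 = m 2 1 * m 2 1 + m 3 1 * m 3 1"
    proof -
      have "m 3 2 * (m 2 5 + m 3 6) = m 1 6 * m 2 1 - m 1 5 * m 3 1"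
        using JJn[of "e 5" 3] by (simp add: Jn e_nth z algebra_simps)
      hence "?p * (m 3 2 * (m 2 5 + m 3 6)) = ?p * m 1 6 * m 2 1 - ?p * m 1 5 * m 3 1"
        by (simp only: right_diff_distrib mult.assoc)
      hence "m 3 2 * (?p * m 2 5 + ?p * m 3 6) = m 3 2 * (m 2 1 * m 2 1 + m 3 1 * m 3 1)"
        unfolding calculation(2,3) by (simp add: algebra_simps)
      thus ?thesis using \<epsilon> by auto
    qed
    ultimately show ?thesis
      using \<epsilon> p by (simp add: admissible_def \<psi> z power2_eq_square algebra_simps)
  qed
  ultimately show ?thesis by blast
qed

lemma J_families_admissible:
  assumes "J \<in> J_families" shows "\<exists>\<epsilon> \<psi>. J = J_psi \<epsilon> \<psi> \<and> admissible \<epsilon> \<psi>"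
  using assms J_family1_admissible J_family2_admissible J_family3_admissible J_family4_admissible
  unfolding J_families_def by blast

lemma admissible_J_families_sign:
  assumes "admissible \<epsilon> \<psi>"
  shows "\<exists>J'\<in>J_families. J_psi \<epsilon> \<psi> = J' \<or> J_psi \<epsilon> \<psi> = (\<lambda>X. - J' X)"
proof (cases "\<epsilon> = 1")
  case True
  thus ?thesis using assms admissible_J_families by blast
next
  case False
  hence \<epsilon>: "\<epsilon> = - 1" using assms by (simp add: admissible_def)
  let ?J = "J_psi 1 (\<lambda>i j. - \<psi> i j)"
  have "?J \<in> J_families"
    using assms admissible_uminus[of \<epsilon> \<psi>] by (intro admissible_J_families) (simp add: \<epsilon>)
  moreover have "J_psi \<epsilon> \<psi> = (\<lambda>X. - ?J X)"
    by (simp add: uminus_J_psi \<epsilon>)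
  ultimately show ?thesis by blast
qed

lemma J_families_integrable_compatible:
  assumes J': "J' \<in> J_families" and J: "J \<in> {J', \<lambda>X. - J' X}"
  shows "integrable_complex g4 J" and "complex_compatible J Omega01"
proof -
  have b: "bilinear g4" "bilinear Omega01"
    using g4_lie_bracket omega1_two_form
    by (auto simp: lie_bracket_def two_form_def Omega01_eq Omega_eq_omega1)
  have *: "integrable_complex g4 J'" "complex_compatible J' Omega01"
    using J_families_admissible[OF J'] admissible_integrable by blast+
  show "integrable_complex g4 J" "complex_compatible J Omega01"
    using J * integrable_complex_uminus[OF b(1)] complex_compatible_uminus[OF b(2)] by auto
qed

theorem theorem3p4:
  shows
    "\<not> (\<exists>\<omega>. symplectic g4 \<omega>)
     \<and> (paracomplex g4 P0
        \<and> (\<forall>a b c. a \<noteq> 0 \<and> b \<noteq> 0 \<and> c \<noteq> 0 \<longrightarrow>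
             semi_para_kahler g4 (Omega a b c) P0 (\<lambda>X Y. Omega a b c X (P0 Y)) \<and>
             scalar_curvature g4 (\<lambda>X Y. Omega a b c X (P0 Y)) = 0))
     \<and> (\<forall>\<omega> \<in> {omega1, omega2}.
          (\<exists>w. nondegenerate (\<omega> w)) \<and>
          (\<forall>w. nondegenerate (\<omega> w) \<longrightarrow>
             semi_kahler_form g4 (\<omega> w) \<and> para_compatible P0 (\<omega> w) \<and>
             semi_para_kahler g4 (\<omega> w) P0 (\<lambda>X Y. \<omega> w X (P0 Y)) \<and>
             scalar_curvature g4 (\<lambda>X Y. \<omega> w X (P0 Y)) = 0))
     \<and> ((\<forall>J. integrable_complex g4 J \<and> complex_compatible J Omega01 \<longleftrightarrow>
             (\<exists>J'\<in>J_families. J = J' \<or> J = (\<lambda>X. - J' X)))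
        \<and> (\<forall>J'\<in>J_families. \<forall>J\<in>{J', \<lambda>X. - J' X}.
             integrable_complex g4 J \<and>
             semi_kahler g4 Omega01 J (\<lambda>X Y. Omega01 X (J Y))))"
proof (intro conjI)
  show "\<not> (\<exists>\<omega>. symplectic g4 \<omega>)" using g4_no_symplectic by blast
  show "paracomplex g4 P0" by (rule paracomplex_P0)
  show "\<forall>a b c. a \<noteq> 0 \<and> b \<noteq> 0 \<and> c \<noteq> 0 \<longrightarrow>
      semi_para_kahler g4 (Omega a b c) P0 (\<lambda>X Y. Omega a b c X (P0 Y)) \<and>
      scalar_curvature g4 (\<lambda>X Y. Omega a b c X (P0 Y)) = 0"
    using nondegenerate_Omega omega1_semi_para_kahler omega1_scalar_curvature
    unfolding Omega_eq_omega1 by blast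
  show "\<forall>\<omega> \<in> {omega1, omega2}.
      (\<exists>w. nondegenerate (\<omega> w)) \<and>
      (\<forall>w. nondegenerate (\<omega> w) \<longrightarrow>
         semi_kahler_form g4 (\<omega> w) \<and> para_compatible P0 (\<omega> w) \<and>
         semi_para_kahler g4 (\<omega> w) P0 (\<lambda>X Y. \<omega> w X (P0 Y)) \<and>
         scalar_curvature g4 (\<lambda>X Y. \<omega> w X (P0 Y)) = 0)"
  proof -
    have "\<exists>w. nondegenerate (omega1 w)" "\<exists>w. nondegenerate (omega2 w)"
      using nondegenerate_Omega[of 1 1 1] nondegenerate_omega2_ex unfolding Omega_eq_omega1 by auto
    moreover have "semi_kahler_form g4 (omega1 w) \<and> para_compatible P0 (omega1 w) \<and>
        semi_para_kahler g4 (omega1 w) P0 (\<lambda>X Y. omega1 w X (P0 Y)) \<and>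
        scalar_curvature g4 (\<lambda>X Y. omega1 w X (P0 Y)) = 0" if "nondegenerate (omega1 w)" for w
      using that by (simp add: omega1_semi_kahler_form omega1_para_compatible omega1_semi_para_kahler
          omega1_scalar_curvature)
    ultimately show ?thesis
      by (auto simp: omega2_eq_omega1)
  qed
  show "\<forall>J. integrable_complex g4 J \<and> complex_compatible J Omega01 \<longleftrightarrow>
      (\<exists>J'\<in>J_families. J = J' \<or> J = (\<lambda>X. - J' X))"
  proof (intro allI iffI)
    fix J assume "integrable_complex g4 J \<and> complex_compatible J Omega01"
    then obtain \<epsilon> \<psi> where "J = J_psi \<epsilon> \<psi>" "admissible \<epsilon> \<psi>"
      using integrable_compatible_admissible by blast
    thus "\<exists>J'\<in>J_families. J = J' \<or> J = (\<lambda>X. - J' X)"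
      using admissible_J_families_sign by blast
  next
    fix J assume "\<exists>J'\<in>J_families. J = J' \<or> J = (\<lambda>X. - J' X)"
    then obtain J' where "J' \<in> J_families" "J \<in> {J', \<lambda>X. - J' X}" by blast
    thus "integrable_complex g4 J \<and> complex_compatible J Omega01"
      using J_families_integrable_compatible by blast
  qed
  show "\<forall>J'\<in>J_families. \<forall>J\<in>{J', \<lambda>X. - J' X}.
      integrable_complex g4 J \<and> semi_kahler g4 Omega01 J (\<lambda>X Y. Omega01 X (J Y))"
  proof (intro ballI conjI)
    fix J' J assume "J' \<in> J_families" "J \<in> {J', \<lambda>X. - J' X}"
    note J = J_families_integrable_compatible[OF this]
    show "integrable_complex g4 J" by (rule J(1))
    show "semi_kahler g4 Omega01 J (\<lambda>X Y. Omega01 X (J Y))"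
      using J by (intro semi_kahler_Omega01) (auto simp: integrable_complex_def)
  qed
qed

end
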